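(* Let $\mathcal A$, $\varepsilon$, $a$, $Q$, $R^\pm$, $\sigma^I$, $\overline\sigma^I_\pm$ and $X_I$ be as in the context. For each choice of sign, the space $\mathcal M$ spanned by the $X_I$ is endowed with a metric $G_\pm^{IJ}$ given by $$G_\pm^{IJ}=\frac1Q\,\varepsilon^{\alpha\nu}\,\sigma^I_{\alpha\dot\beta}\,\overline\sigma_\pm^{J\dot\beta\gamma}\,\varepsilon_{\gamma\nu}=\frac1Q\,\varepsilon_{\dot\nu\dot\gamma}\,\overline\sigma_\pm^{I\dot\gamma\alpha}\,\sigma^J_{\alpha\dot\beta}\,\varepsilon^{\dot\nu\dot\beta}$$ (in particular the two expressions are equal), such that: (a) $G_\pm^{IJ}X_IX_J$ is invariant under the quantum $SL(2,\mathbb C)$ group, i.e. $\Delta_L(G_\pm^{IJ}X_IX_J)=I_{\mathcal A}\otimes G_\pm^{IJ}X_IX_J$. (b) If the matrices $\sigma^I$ are hermitean, i.e. $(\sigma^I_{\alpha\dot\beta})^\star=\sigma^I_{\beta\dot\alpha}$, then $G_\pm$ is hermitean, i.e. $(G_\pm^{IJ})^\star=G_\pm^{JI}$.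
   Context: Conventions. Spinor indices $\alpha,\beta,\dots$ and dotted indices $\dot\alpha,\dot\beta,\dots$ run over $\{1,2\}$; $I,J,\dots$ run over $\{0,1,2,3\}$. Repeated indices are summed; an undotted index $\alpha$ and the dotted index $\dot\alpha$ with the same letter have the same numerical value. On complex numbers $\star$ is complex conjugation. In formulas with $\pm,\mp$ the upper signs go together and the lower signs go together. Spinor metric. $(\varepsilon_{\alpha\beta})$ is an invertible complex $2\times2$ matrix with inverse $(\varepsilon^{\alpha\beta})$: $\varepsilon^{\alpha\gamma}\varepsilon_{\gamma\beta}=\delta^\alpha_\beta=\varepsilon_{\beta\gamma}\varepsilon^{\gamma\alpha}$. Dotted versions: $\varepsilon_{\dot\beta\dot\alpha}:=(\varepsilon_{\alpha\beta})^\star$, $\varepsilon^{\dot\beta\dot\alpha}:=(\varepsilon^{\alpha\beta})^\star$. It is assumed that $\varepsilon_{\dot\beta\dot\alpha}=-\varepsilon^{\alpha\beta}$ and $\varepsilon^{\dot\beta\dot\alpha}=-\varepsilon_{\alpha\beta}$. $R$ matrices. $a\neq0$ is a real number with $a+a^{-1}+\varepsilon^{\alpha\beta}\varepsilon_{\alpha\beta}=0$ (then $a>0$, and $a^{1/2}$ is the positive root), $Q:=a+a^{-1}=-\varepsilon_{\alpha\beta}\varepsilon^{\alpha\beta}$, and $R^{\pm\alpha\beta}_{\ \ \gamma\delta}=\delta^\alpha_\gamma\delta^\beta_\delta+a^{\pm1}\varepsilon^{\alpha\beta}\varepsilon_{\gamma\delta}$. Mixed $R$ matrices are defined by $R^{\pm\dot\delta\gamma}_{\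 \ \alpha\dot\sigma}:=a^{\pm1/2}R^{\mp\gamma\sigma}_{\ \ \delta\alpha}$ and $R^{\mp\gamma\dot\delta}_{\ \ \dot\sigma\alpha}:=a^{\pm1/2}\varepsilon_{\delta\lambda}R^{\mp\gamma\lambda}_{\ \ \nu\alpha}\varepsilon^{\nu\sigma}$. The $\star$-Hopf algebra $\mathcal A$ (quantum $SL(2,\mathbb C)$). $\mathcal A$ is a complex unital $\star$-algebra with unit $I_{\mathcal A}$ ($\star$ antilinear and antimultiplicative) generated by $M_\alpha{}^\beta$ and $M_{\dot\alpha}{}^{\dot\beta}:=(M_\alpha{}^\beta)^\star$, satisfying $\varepsilon_{\alpha\beta}M_\gamma{}^\alpha M_\delta{}^\beta=\varepsilon_{\gamma\delta}I_{\mathcal A}$, $\varepsilon^{\gamma\delta}M_\gamma{}^\alpha M_\delta{}^\beta=\varepsilon^{\alpha\beta}I_{\mathcal A}$, the same relations with all indices dotted, and, for both signs, $M_\alpha{}^\gamma M_{\dot\sigma}{}^{\dot\delta}R^{\pm\dot\rho\beta}_{\ \ \gamma\dot\delta}=R^{\pm\dot\delta\gamma}_{\ \ \alpha\dot\sigma}M_{\dot\delta}{}^{\dot\rho}M_\gamma{}^\beta$. It is a $\star$-Hopf algebra with $\Delta(M_\alpha{}^\beta)=M_\alpha{}^\gamma\otimes M_\gamma{}^\beta$, counit $\varepsilon(M_\alpha{}^\beta)=\delta_\alpha^\beta$, antipode $S(M_\alpha{}^\beta)=\varepsilon_{\alpha\gamma}M_\delta{}^\gamma\varepsilon^{\delta\beta}$,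 and the same formulas with dotted indices. Bispinors. $\sigma^I=(\sigma^I_{\alpha\dot\beta})$, $I=0,\dots,3$, are four linearly independent complex $2\times2$ matrices and $\overline\sigma_\pm^{I\dot\alpha\beta}:=\varepsilon^{\dot\alpha\dot\lambda}R^{\mp\sigma\dot\rho}_{\ \ \dot\lambda\nu}\varepsilon^{\nu\beta}\sigma^I_{\sigma\dot\rho}$. The elements $X_I$ are defined by $X_{\alpha\dot\beta}=X_I\sigma^I_{\alpha\dot\beta}$, where the $X_{\alpha\dot\beta}$ carry the left $\mathcal A$-coaction $\Delta_L(X_{\alpha\dot\beta})=M_\alpha{}^\sigma M_{\dot\beta}{}^{\dot\rho}\otimes X_{\sigma\dot\rho}$; products $X_IX_J$ are taken in an algebra generated by the $X_I$ on which $\Delta_L$ is multiplicative. *)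

theory Defs
  imports "HOL-Analysis.Analysis"
begin

section \<open>Complex vector spaces and algebras\<close>

class scaleC =
  fixes scaleC :: "complex \<Rightarrow> 'a \<Rightarrow> 'a"  (infixr \<open>*\<^sub>C\<close> 75)

class complex_vector = scaleC + ab_group_add +
  assumes scaleC_add_right: "c *\<^sub>C (x + y) = c *\<^sub>C x + c *\<^sub>C y"
    and scaleC_add_left: "(c + d) *\<^sub>C x = c *\<^sub>C x + d *\<^sub>C x"
    and scaleC_scaleC: "c *\<^sub>C d *\<^sub>C x = (c * d) *\<^sub>C x"
    and scaleC_one: "1 *\<^sub>C x = x"

text \<open>Associative unital complex algebras; \<open>0 = 1\<close> is not excluded, so that the tensor product
  below is an instance without further argument.\<close>

class complex_algebra_1 = complex_vector + ring + monoid_mult +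
  assumes mult_scaleC_left: "(c *\<^sub>C x) * y = c *\<^sub>C (x * y)"
    and mult_scaleC_right: "x * (c *\<^sub>C y) = c *\<^sub>C (x * y)"

global_interpretation complex_vector: vector_space "scaleC :: complex \<Rightarrow> 'a \<Rightarrow> 'a::complex_vector"
  by unfold_locales
    (simp_all add: scaleC_add_right scaleC_add_left scaleC_scaleC scaleC_one)

abbreviation clinear :: "('a::complex_vector \<Rightarrow> 'b::complex_vector) \<Rightarrow> bool"
  where "clinear \<equiv> Vector_Spaces.linear scaleC scaleC"

instantiation complex :: complex_algebra_1
begin
definition scaleC_complex :: "complex \<Rightarrow> complex \<Rightarrow> complex"
  where "scaleC_complex c x = c * x"
instance
  by standard (simp_all add: scaleC_complex_def algebra_simps)
end

definition is_star :: "('a::complex_algebra_1 \<Rightarrow> 'a) \<Rightarrow> bool"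
  where "is_star st \<longleftrightarrow>
    (\<forall>x y. st (x + y) = st x + st y) \<and>
    (\<forall>c x. st (c *\<^sub>C x) = cnj c *\<^sub>C st x) \<and>
    (\<forall>x y. st (x * y) = st y * st x) \<and>
    (\<forall>x. st (st x) = x)"

definition is_alg_hom :: "('a::complex_algebra_1 \<Rightarrow> 'b::complex_algebra_1) \<Rightarrow> bool"
  where "is_alg_hom f \<longleftrightarrow> clinear f \<and> (\<forall>x y. f (x * y) = f x * f y) \<and> f 1 = 1"

inductive_set generated_algebra :: "'a::complex_algebra_1 set \<Rightarrow> 'a set" for S
  where
    one: "1 \<in> generated_algebra S"
  | base: "x \<in> S \<Longrightarrow> x \<in> generated_algebra S"
  | add: "x \<in> generated_algebra S \<Longrightarrow> y \<in> generated_algebra S \<Longrightarrow> x + y \<in> generated_algebra S"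
  | mult: "x \<in> generated_algebra S \<Longrightarrow> y \<in> generated_algebra S \<Longrightarrow> x * y \<in> generated_algebra S"
  | scale: "x \<in> generated_algebra S \<Longrightarrow> c *\<^sub>C x \<in> generated_algebra S"


section \<open>The algebraic tensor product over the complex numbers\<close>

text \<open>A list \<open>[(a\<^sub>1, b\<^sub>1), \<dots>, (a\<^sub>n, b\<^sub>n)]\<close> stands for the formal sum of the \<open>a\<^sub>i \<otimes> b\<^sub>i\<close>.
  The relation is the least congruence that makes formal sums commutative and \<open>\<otimes>\<close> bilinear.\<close>

inductive tensor_rel ::
  "('a::complex_vector \<times> 'b::complex_vector) list \<Rightarrow> ('a \<times> 'b) list \<Rightarrow> bool"
  where
    refl: "tensor_rel xs xs"
  | sym: "tensor_rel xs ys \<Longrightarrow> tensor_rel ys xs"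
  | trans: "tensor_rel xs ys \<Longrightarrow> tensor_rel ys zs \<Longrightarrow> tensor_rel xs zs"
  | append: "tensor_rel xs xs' \<Longrightarrow> tensor_rel ys ys' \<Longrightarrow> tensor_rel (xs @ ys) (xs' @ ys')"
  | comm: "tensor_rel (xs @ ys) (ys @ xs)"
  | zero: "tensor_rel [(0, b)] []"
  | add_left: "tensor_rel [(a + a', b)] [(a, b), (a', b)]"
  | add_right: "tensor_rel [(a, b + b')] [(a, b), (a, b')]"
  | scale: "tensor_rel [(c *\<^sub>C a, b)] [(a, c *\<^sub>C b)]"

quotient_type (overloaded) ('a, 'b) tensor = "('a::complex_vector \<times> 'b::complex_vector) list" / tensor_rel
  by (rule equivpI)
    (auto intro: reflpI sympI transpI tensor_rel.refl tensor_rel.sym tensor_rel.trans)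

lift_definition pure_tensor ::
  "'a::complex_vector \<Rightarrow> 'b::complex_vector \<Rightarrow> ('a, 'b) tensor"  (infixr \<open>\<otimes>\<close> 68)
  is "\<lambda>a b. [(a, b)]" .

instantiation tensor :: (complex_vector, complex_vector) complex_vector
begin

lift_definition zero_tensor :: "('a, 'b) tensor" is "[]" .

lift_definition plus_tensor :: "('a, 'b) tensor \<Rightarrow> ('a, 'b) tensor \<Rightarrow> ('a, 'b) tensor"
  is "(@)" by (rule tensor_rel.append)

lift_definition scaleC_tensor :: "complex \<Rightarrow> ('a, 'b) tensor \<Rightarrow> ('a, 'b) tensor"
  is "\<lambda>c. map (\<lambda>(a, b). (c *\<^sub>C a, b))"
proof -
  fix c :: complex and xs ys :: "('a \<times> 'b) list"
  show "tensor_rel xs ys \<Longrightarrow>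
    tensor_rel (map (\<lambda>(a, b). (c *\<^sub>C a, b)) xs) (map (\<lambda>(a, b). (c *\<^sub>C a, b)) ys)"
  proof (induction rule: tensor_rel.induct)
    case (scale d a b)
    show ?case
      using tensor_rel.scale[of d "c *\<^sub>C a" b]
      by (simp add: scaleC_scaleC mult.commute)
  qed (auto intro: tensor_rel.intros simp: scaleC_add_right)
qed

definition uminus_tensor :: "('a, 'b) tensor \<Rightarrow> ('a, 'b) tensor"
  where "uminus_tensor x = (- 1) *\<^sub>C x"

definition minus_tensor :: "('a, 'b) tensor \<Rightarrow> ('a, 'b) tensor \<Rightarrow> ('a, 'b) tensor"
  where "minus_tensor x y = x + - y" for x y :: "('a, 'b) tensor"

lemma tensor_add_assoc: "(x + y) + z = x + (y + z)" for x y z :: "('a, 'b) tensor"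
  by transfer (simp add: tensor_rel.refl)

lemma tensor_add_commute: "x + y = y + x" for x y :: "('a, 'b) tensor"
  by transfer (rule tensor_rel.comm)

lemma tensor_zero_add: "0 + x = x" for x :: "('a, 'b) tensor"
  by transfer (simp add: tensor_rel.refl)

lemma tensor_induct0:
  fixes x :: "('a, 'b) tensor"
  assumes "P 0" "\<And>a b. P (a \<otimes> b)" "\<And>x y. P x \<Longrightarrow> P y \<Longrightarrow> P (x + y)"
  shows "P x"
proof -
  have "P (abs_tensor xs)" for xs
  proof (induction xs)
    case Nil
    then show ?case using assms(1) by (simp add: zero_tensor_def)
  next
    case (Cons p xs)
    have "abs_tensor (p # xs) = (fst p \<otimes> snd p) + abs_tensor xs"
      by (simp add: pure_tensor.abs_eq plus_tensor.abs_eq)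
    then show ?case using assms(2,3) Cons by simp
  qed
  then show ?thesis by (metis Quotient_abs_rep Quotient_tensor)
qed

lemma tensor_scale_add:
  "c *\<^sub>C (x + y) = c *\<^sub>C x + c *\<^sub>C y" for x y :: "('a, 'b) tensor"
  by transfer (simp add: tensor_rel.refl)

lemma tensor_scale_zero: "c *\<^sub>C 0 = (0 :: ('a, 'b) tensor)"
  by transfer (simp add: tensor_rel.refl)

lemma tensor_scale_pure: "c *\<^sub>C (a \<otimes> b) = (c *\<^sub>C a) \<otimes> b" for a :: 'a and b :: 'b
  by transfer (simp add: tensor_rel.refl)

lemma tensor_pure_add_left: "(a + a') \<otimes> b = a \<otimes> b + a' \<otimes> b" for a a' :: 'a and b :: 'b
  by transfer (simp add: tensor_rel.add_left)

lemma tensor_pure_zero_left: "(0 :: 'a) \<otimes> b = 0" for b :: 'b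
  by transfer (rule tensor_rel.zero)

lemma tensor_scale_add_left:
  "(c + d) *\<^sub>C x = c *\<^sub>C x + d *\<^sub>C x" for x :: "('a, 'b) tensor"
proof (induction x rule: tensor_induct0)
  case (3 x y)
  have "c *\<^sub>C (x + y) + d *\<^sub>C (x + y) = (c *\<^sub>C x + c *\<^sub>C y) + (d *\<^sub>C x + d *\<^sub>C y)"
    by (simp add: tensor_scale_add)
  also have "\<dots> = (c *\<^sub>C x + d *\<^sub>C x) + (c *\<^sub>C y + d *\<^sub>C y)"
    by (metis tensor_add_assoc tensor_add_commute)
  finally show ?case
    using 3 by (simp add: tensor_scale_add)
qed (simp_all add: tensor_scale_zero tensor_zero_add tensor_scale_pure scaleC_add_left
      tensor_pure_add_left)

lemma tensor_scale_0: "0 *\<^sub>C x = (0 :: ('a, 'b) tensor)"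
  by (induction x rule: tensor_induct0)
    (simp_all add: tensor_scale_zero tensor_zero_add tensor_scale_pure tensor_pure_zero_left
      tensor_scale_add)

lemma tensor_scale_1: "1 *\<^sub>C x = x" for x :: "('a, 'b) tensor"
  by (induction x rule: tensor_induct0)
    (simp_all add: tensor_scale_zero tensor_scale_pure scaleC_one tensor_scale_add)

instance
proof
  fix x y z :: "('a, 'b) tensor" and c d :: complex
  show "x + y + z = x + (y + z)" by (rule tensor_add_assoc)
  show "x + y = y + x" by (rule tensor_add_commute)
  show "0 + x = x" by (rule tensor_zero_add)
  show "- x + x = 0"
    using tensor_scale_add_left[of "- 1" 1 x]
    by (simp add: uminus_tensor_def tensor_scale_1 tensor_scale_0)
  show "x - y = x + - y" by (simp add: minus_tensor_def)
  show "c *\<^sub>C (x + y) = c *\<^sub>C x + c *\<^sub>C y" by (rule tensor_scale_add)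
  show "(c + d) *\<^sub>C x = c *\<^sub>C x + d *\<^sub>C x" by (rule tensor_scale_add_left)
  show "1 *\<^sub>C x = x" by (rule tensor_scale_1)
  show "c *\<^sub>C d *\<^sub>C x = (c * d) *\<^sub>C x"
    by (induction x rule: tensor_induct0)
      (simp_all add: tensor_scale_zero tensor_scale_pure scaleC_scaleC tensor_scale_add)
qed

end

lemma tensor_induct [case_names zero pure add, induct type: tensor]:
  assumes "P 0" "\<And>a b. P (a \<otimes> b)" "\<And>x y. P x \<Longrightarrow> P y \<Longrightarrow> P (x + y)"
  shows "P x"
  using assms by (rule tensor_induct0)

lemma pure_tensor_add_left: "(a + a') \<otimes> b = a \<otimes> b + a' \<otimes> b"
  by (rule tensor_pure_add_left)

lemma pure_tensor_add_right: "a \<otimes> (b + b') = a \<otimes> b + a \<otimes> b'"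
  by transfer (simp add: tensor_rel.add_right)

lemma pure_tensor_scale_left: "(c *\<^sub>C a) \<otimes> b = c *\<^sub>C (a \<otimes> b)"
  by (simp add: tensor_scale_pure)

lemma pure_tensor_scale_right: "a \<otimes> (c *\<^sub>C b) = c *\<^sub>C (a \<otimes> b)"
  unfolding tensor_scale_pure by transfer (rule tensor_rel.sym, rule tensor_rel.scale)

text \<open>\<open>tensor_lift f\<close> sends \<open>a \<otimes> b\<close> to \<open>f a b\<close>. It does not depend on the chosen representative
  as soon as \<open>f\<close> is balanced (in particular if \<open>f\<close> is bilinear or antilinear in both arguments).\<close>

definition tensor_lift ::
  "('a::complex_vector \<Rightarrow> 'b::complex_vector \<Rightarrow> 'c::ab_group_add) \<Rightarrow> ('a, 'b) tensor \<Rightarrow> 'c"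
  where "tensor_lift f x = (\<Sum>(a, b)\<leftarrow>rep_tensor x. f a b)"

definition balanced ::
  "('a::complex_vector \<Rightarrow> 'b::complex_vector \<Rightarrow> 'c::ab_group_add) \<Rightarrow> bool"
  where "balanced f \<longleftrightarrow>
    (\<forall>a a' b. f (a + a') b = f a b + f a' b) \<and>
    (\<forall>a b b'. f a (b + b') = f a b + f a b') \<and>
    (\<forall>c a b. f (c *\<^sub>C a) b = f a (c *\<^sub>C b))"

lemma balancedI:
  assumes "\<And>a a' b. f (a + a') b = f a b + f a' b"
    and "\<And>a b b'. f a (b + b') = f a b + f a b'"
    and "\<And>c a b. f (c *\<^sub>C a) b = f a (c *\<^sub>C b)"
  shows "balanced f"
  using assms by (simp add: balanced_def)

lemma balanced_sum_list:
  assumes "balanced f" "tensor_rel xs ys"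
  shows "(\<Sum>(a, b)\<leftarrow>xs. f a b) = (\<Sum>(a, b)\<leftarrow>ys. f a b)"
  using assms(2)
proof (induction rule: tensor_rel.induct)
  case (zero b)
  have "f (0 + 0) b = f 0 b + f 0 b"
    using assms(1) unfolding balanced_def by blast
  then show ?case by simp
qed (use assms(1) in \<open>auto simp: balanced_def add.commute\<close>)

lemma tensor_lift_abs:
  assumes "balanced f"
  shows "tensor_lift f (abs_tensor xs) = (\<Sum>(a, b)\<leftarrow>xs. f a b)"
  unfolding tensor_lift_def
  by (rule balanced_sum_list[OF assms])
    (simp add: tensor.abs_eq_iff[symmetric] Quotient3_abs_rep[OF Quotient3_tensor])

lemma tensor_lift_pure: "balanced f \<Longrightarrow> tensor_lift f (a \<otimes> b) = f a b"
  by (simp add: pure_tensor.abs_eq tensor_lift_abs)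

lemma tensor_lift_zero: "balanced f \<Longrightarrow> tensor_lift f 0 = 0"
  by (simp add: zero_tensor_def tensor_lift_abs)

lemma tensor_lift_add:
  assumes "balanced f"
  shows "tensor_lift f (x + y) = tensor_lift f x + tensor_lift f y"
proof -
  obtain xs ys where "x = abs_tensor xs" "y = abs_tensor ys"
    by (metis Quotient_abs_rep Quotient_tensor)
  then show ?thesis
    by (simp add: plus_tensor.abs_eq tensor_lift_abs[OF assms])
qed

instantiation tensor :: (complex_algebra_1, complex_algebra_1) complex_algebra_1
begin

definition one_tensor :: "('a, 'b) tensor"
  where "one_tensor = 1 \<otimes> 1"

definition times_tensor :: "('a, 'b) tensor \<Rightarrow> ('a, 'b) tensor \<Rightarrow> ('a, 'b) tensor"
  where "times_tensor x y =
    tensor_lift (\<lambda>a b. tensor_lift (\<lambda>a' b'. (a * a') \<otimes> (b * b')) y) x"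

lemma balanced_times_inner: "balanced (\<lambda>a' b'. (a * a') \<otimes> (b * b'))" for a :: 'a and b :: 'b
  by (rule balancedI)
    (simp_all add: distrib_left pure_tensor_add_left pure_tensor_add_right
      mult_scaleC_right pure_tensor_scale_left pure_tensor_scale_right)

lemma balanced_times_outer:
  "balanced (\<lambda>a b. tensor_lift (\<lambda>a' b'. (a * a') \<otimes> (b * b')) y)" for y :: "('a, 'b) tensor"
proof (induction y)
  case zero
  then show ?case
    by (simp add: tensor_lift_zero[OF balanced_times_inner] balanced_def)
next
  case (pure a b)
  then show ?case
    by (simp add: tensor_lift_pure[OF balanced_times_inner] balanced_def distrib_right
        pure_tensor_add_left pure_tensor_add_right mult_scaleC_left pure_tensor_scale_left
        pure_tensor_scale_right)
next
  case (add x y)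
  then show ?case
    by (simp add: tensor_lift_add[OF balanced_times_inner] balanced_def)
qed

lemma tensor_times_pure_left:
  "(a \<otimes> b) * y = tensor_lift (\<lambda>a' b'. (a * a') \<otimes> (b * b')) y"
  for a :: 'a and b :: 'b and y :: "('a, 'b) tensor"
  unfolding times_tensor_def by (rule tensor_lift_pure[OF balanced_times_outer])

lemma tensor_times_pure: "(a \<otimes> b) * (a' \<otimes> b') = (a * a') \<otimes> (b * b')"
  for a a' :: 'a and b b' :: 'b
  unfolding tensor_times_pure_left by (rule tensor_lift_pure[OF balanced_times_inner])

lemma tensor_times_zero_left: "0 * y = 0" for y :: "('a, 'b) tensor"
  by (simp add: times_tensor_def tensor_lift_zero[OF balanced_times_outer])

lemma tensor_times_add_left: "(x + x') * y = x * y + x' * y" for x y :: "('a, 'b) tensor"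
  by (simp add: times_tensor_def tensor_lift_add[OF balanced_times_outer])

lemma tensor_times_zero_right: "x * 0 = 0" for x :: "('a, 'b) tensor"
  by (induction x)
    (simp_all add: tensor_times_zero_left tensor_times_add_left tensor_times_pure_left
      tensor_lift_zero[OF balanced_times_inner])

lemma tensor_times_add_right: "x * (y + y') = x * y + x * y'" for x y :: "('a, 'b) tensor"
  by (induction x)
    (simp_all add: tensor_times_zero_left tensor_times_add_left tensor_times_pure_left
      tensor_lift_add[OF balanced_times_inner] algebra_simps)

lemmas tensor_times_simps = tensor_times_pure tensor_times_zero_left tensor_times_add_left
  tensor_times_zero_right tensor_times_add_right

lemma tensor_times_assoc_pure:
  "(a \<otimes> b) * (a' \<otimes> b') * z = (a \<otimes> b) * ((a' \<otimes> b') * z)"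
  for a a' :: 'a and b b' :: 'b and z :: "('a, 'b) tensor"
  by (induction z) (simp_all add: tensor_times_simps mult.assoc)

lemma tensor_times_assoc_pure_left:
  "(a \<otimes> b) * y * z = (a \<otimes> b) * (y * z)" for a :: 'a and b :: 'b and y z :: "('a, 'b) tensor"
  by (induction y)
    (simp_all only: tensor_times_assoc_pure tensor_times_zero_left tensor_times_zero_right
      tensor_times_add_left tensor_times_add_right)

lemma tensor_times_scale_pure:
  "(c *\<^sub>C (a \<otimes> b)) * y = c *\<^sub>C ((a \<otimes> b) * y)" "(a \<otimes> b) * (c *\<^sub>C y) = c *\<^sub>C ((a \<otimes> b) * y)"
  for a :: 'a and b :: 'b and y :: "('a, 'b) tensor"
  by (induction y)
    (simp_all add: tensor_times_simps tensor_scale_pure mult_scaleC_left mult_scaleC_right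
      scaleC_add_right)

instance
proof
  fix x y z :: "('a, 'b) tensor" and c :: complex
  show "x * y * z = x * (y * z)"
    by (induction x)
      (simp_all only: tensor_times_assoc_pure_left tensor_times_zero_left tensor_times_add_left)
  show "(x + y) * z = x * z + y * z" by (rule tensor_times_add_left)
  show "x * (y + z) = x * y + x * z" by (rule tensor_times_add_right)
  show "1 * x = x" "x * 1 = x"
    by (induction x) (simp_all add: one_tensor_def tensor_times_simps)
  show "(c *\<^sub>C x) * y = c *\<^sub>C (x * y)"
    by (induction x)
      (simp_all only: tensor_times_scale_pure scaleC_add_right tensor_times_add_left
        tensor_times_zero_left complex_vector.scale_zero_right)
  show "x * (c *\<^sub>C y) = c *\<^sub>C (x * y)"
    by (induction x)
      (simp_all only: tensor_times_scale_pure scaleC_add_right tensor_times_add_left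
        tensor_times_zero_left complex_vector.scale_zero_right)
qed

end

definition tensor_map ::
  "('a::complex_vector \<Rightarrow> 'c::complex_vector) \<Rightarrow> ('b::complex_vector \<Rightarrow> 'd::complex_vector) \<Rightarrow>
   ('a, 'b) tensor \<Rightarrow> ('c, 'd) tensor"
  where "tensor_map f g = tensor_lift (\<lambda>a b. f a \<otimes> g b)"

definition tensor_assoc ::
  "(('a::complex_vector, 'b::complex_vector) tensor, 'c::complex_vector) tensor \<Rightarrow>
   ('a, ('b, 'c) tensor) tensor"
  where "tensor_assoc = tensor_lift (\<lambda>x c. tensor_lift (\<lambda>a b. a \<otimes> (b \<otimes> c)) x)"


section \<open>Hopf star-algebras and coactions\<close>

definition is_star_Hopf_algebra ::
  "('a::complex_algebra_1 \<Rightarrow> 'a) \<Rightarrow> ('a \<Rightarrow> ('a, 'a) tensor) \<Rightarrow> ('a \<Rightarrow> complex) \<Rightarrow> ('a \<Rightarrow> 'a) \<Rightarrow> bool"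
  where "is_star_Hopf_algebra st \<Delta> \<epsilon> S \<longleftrightarrow>
    is_star st \<and> is_alg_hom \<Delta> \<and> is_alg_hom \<epsilon> \<and> clinear S \<and>
    (\<forall>x. tensor_assoc (tensor_map \<Delta> id (\<Delta> x)) = tensor_map id \<Delta> (\<Delta> x)) \<and>
    (\<forall>x. tensor_lift (\<lambda>y z. \<epsilon> y *\<^sub>C z) (\<Delta> x) = x) \<and>
    (\<forall>x. tensor_lift (\<lambda>y z. \<epsilon> z *\<^sub>C y) (\<Delta> x) = x) \<and>
    (\<forall>x. tensor_lift (\<lambda>y z. S y * z) (\<Delta> x) = \<epsilon> x *\<^sub>C 1) \<and>
    (\<forall>x. tensor_lift (\<lambda>y z. y * S z) (\<Delta> x) = \<epsilon> x *\<^sub>C 1) \<and>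
    (\<forall>x. \<Delta> (st x) = tensor_map st st (\<Delta> x)) \<and>
    (\<forall>x. \<epsilon> (st x) = cnj (\<epsilon> x))"

definition is_left_coaction ::
  "('a::complex_algebra_1 \<Rightarrow> ('a, 'a) tensor) \<Rightarrow> ('a \<Rightarrow> complex) \<Rightarrow>
   ('b::complex_vector \<Rightarrow> ('a, 'b) tensor) \<Rightarrow> bool"
  where "is_left_coaction \<Delta> \<epsilon> \<Delta>\<^sub>L \<longleftrightarrow>
    clinear \<Delta>\<^sub>L \<and>
    (\<forall>x. tensor_assoc (tensor_map \<Delta> id (\<Delta>\<^sub>L x)) = tensor_map id \<Delta>\<^sub>L (\<Delta>\<^sub>L x)) \<and>
    (\<forall>x. tensor_lift (\<lambda>y z. \<epsilon> y *\<^sub>C z) (\<Delta>\<^sub>L x) = x)"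


section \<open>Spinor metric and R matrices\<close>

text \<open>Spinor indices have type \<^typ>\<open>2\<close> and vector indices type \<^typ>\<open>4\<close> (where \<open>2 = 0\<close> and \<open>4 = 0\<close>
  respectively). Indices are written as arguments in the order in which they are read, upper ones
  first; the matrix \<open>e\<close> is the one with the lower indices, \<open>e $ \<alpha> $ \<beta> = \<epsilon>\<^sub>\<alpha>\<^sub>\<beta>\<close>.
  The suffix \<open>d\<close> marks dotted indices.\<close>

definition eps_lo :: "complex^2^2 \<Rightarrow> 2 \<Rightarrow> 2 \<Rightarrow> complex"
  where "eps_lo e \<alpha> \<beta> = e $ \<alpha> $ \<beta>"

definition eps_up :: "complex^2^2 \<Rightarrow> 2 \<Rightarrow> 2 \<Rightarrow> complex"
  where "eps_up e \<alpha> \<beta> = matrix_inv e $ \<alpha> $ \<beta>"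

definition epsd_lo :: "complex^2^2 \<Rightarrow> 2 \<Rightarrow> 2 \<Rightarrow> complex"
  where "epsd_lo e \<beta> \<alpha> = cnj (eps_lo e \<alpha> \<beta>)"

definition epsd_up :: "complex^2^2 \<Rightarrow> 2 \<Rightarrow> 2 \<Rightarrow> complex"
  where "epsd_up e \<beta> \<alpha> = cnj (eps_up e \<alpha> \<beta>)"

definition is_spinor_metric :: "complex^2^2 \<Rightarrow> bool"
  where "is_spinor_metric e \<longleftrightarrow> invertible e \<and>
    (\<forall>\<alpha> \<beta>. epsd_lo e \<beta> \<alpha> = - eps_up e \<alpha> \<beta>) \<and>
    (\<forall>\<alpha> \<beta>. epsd_up e \<beta> \<alpha> = - eps_lo e \<alpha> \<beta>)"

definition is_R_parameter :: "complex^2^2 \<Rightarrow> real \<Rightarrow> bool"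
  where "is_R_parameter e a \<longleftrightarrow> a \<noteq> 0 \<and>
    complex_of_real (a + inverse a) + (\<Sum>\<alpha>\<in>UNIV. \<Sum>\<beta>\<in>UNIV. eps_up e \<alpha> \<beta> * eps_lo e \<alpha> \<beta>) = 0"

definition Q_const :: "real \<Rightarrow> complex"
  where "Q_const a = complex_of_real (a + inverse a)"

datatype pm = Plus | Minus

fun opp :: "pm \<Rightarrow> pm"
  where "opp Plus = Minus" | "opp Minus = Plus"

fun pm_power :: "real \<Rightarrow> pm \<Rightarrow> complex"
  where "pm_power x Plus = complex_of_real x"
  | "pm_power x Minus = complex_of_real (inverse x)"

definition kron :: "2 \<Rightarrow> 2 \<Rightarrow> complex"
  where "kron \<alpha> \<beta> = (if \<alpha> = \<beta> then 1 else 0)"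

definition R_mat :: "complex^2^2 \<Rightarrow> real \<Rightarrow> pm \<Rightarrow> 2 \<Rightarrow> 2 \<Rightarrow> 2 \<Rightarrow> 2 \<Rightarrow> complex"
  where "R_mat e a s \<alpha> \<beta> \<gamma> \<delta> =
    kron \<alpha> \<gamma> * kron \<beta> \<delta> + pm_power a s * eps_up e \<alpha> \<beta> * eps_lo e \<gamma> \<delta>"

text \<open>The two mixed R matrices: \<open>R_du\<close> has index pattern (dotted, undotted; undotted, dotted) and
  \<open>R_ud\<close> has (undotted, dotted; dotted, undotted). The sign argument is always the sign
  carried by the matrix on the left hand side of its definition, so in \<open>R_ud\<close> the power of
  \<open>a\<close> has the opposite sign.\<close>

definition R_du :: "complex^2^2 \<Rightarrow> real \<Rightarrow> pm \<Rightarrow> 2 \<Rightarrow> 2 \<Rightarrow> 2 \<Rightarrow> 2 \<Rightarrow> complex"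
  where "R_du e a s \<delta> \<gamma> \<alpha> \<sigma> = pm_power (sqrt a) s * R_mat e a (opp s) \<gamma> \<sigma> \<delta> \<alpha>"

definition R_ud :: "complex^2^2 \<Rightarrow> real \<Rightarrow> pm \<Rightarrow> 2 \<Rightarrow> 2 \<Rightarrow> 2 \<Rightarrow> 2 \<Rightarrow> complex"
  where "R_ud e a s \<gamma> \<delta> \<sigma> \<alpha> = pm_power (sqrt a) (opp s) *
    (\<Sum>\<kappa>\<in>UNIV. \<Sum>\<nu>\<in>UNIV. eps_lo e \<delta> \<kappa> * R_mat e a s \<gamma> \<kappa> \<nu> \<alpha> * eps_up e \<nu> \<sigma>)"


section \<open>Quantum SL(2,C)\<close>

text \<open>\<open>M \<alpha> \<beta>\<close> is the generator with lower index \<open>\<alpha>\<close> and upper index \<open>\<beta>\<close>; the dotted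
  generators are \<open>st (M \<alpha> \<beta>)\<close>.\<close>

locale quantum_SL2C =
  fixes e :: "complex^2^2" and a :: real
    and st :: "'a::complex_algebra_1 \<Rightarrow> 'a"
    and \<Delta> :: "'a \<Rightarrow> ('a, 'a) tensor"
    and \<epsilon> :: "'a \<Rightarrow> complex"
    and S :: "'a \<Rightarrow> 'a"
    and M :: "2 \<Rightarrow> 2 \<Rightarrow> 'a"
  assumes spinor_metric: "is_spinor_metric e"
    and R_parameter: "is_R_parameter e a"
    and star_Hopf: "is_star_Hopf_algebra st \<Delta> \<epsilon> S"
    and generated:
      "generated_algebra ({M \<alpha> \<beta> | \<alpha> \<beta>. True} \<union> {st (M \<alpha> \<beta>) | \<alpha> \<beta>. True}) = UNIV"
    and eps_lo_M_M: "\<And>\<gamma> \<delta>. (\<Sum>\<alpha>\<in>UNIV. \<Sum>\<beta>\<in>UNIV. eps_lo e \<alpha> \<beta> *\<^sub>C (M \<gamma> \<alpha> * M \<delta> \<beta>))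
        = eps_lo e \<gamma> \<delta> *\<^sub>C 1"
    and eps_up_M_M: "\<And>\<alpha> \<beta>. (\<Sum>\<gamma>\<in>UNIV. \<Sum>\<delta>\<in>UNIV. eps_up e \<gamma> \<delta> *\<^sub>C (M \<gamma> \<alpha> * M \<delta> \<beta>))
        = eps_up e \<alpha> \<beta> *\<^sub>C 1"
    and epsd_lo_M_M: "\<And>\<gamma> \<delta>.
        (\<Sum>\<alpha>\<in>UNIV. \<Sum>\<beta>\<in>UNIV. epsd_lo e \<alpha> \<beta> *\<^sub>C (st (M \<gamma> \<alpha>) * st (M \<delta> \<beta>)))
        = epsd_lo e \<gamma> \<delta> *\<^sub>C 1"
    and epsd_up_M_M: "\<And>\<alpha> \<beta>.
        (\<Sum>\<gamma>\<in>UNIV. \<Sum>\<delta>\<in>UNIV. epsd_up e \<gamma> \<delta> *\<^sub>C (st (M \<gamma> \<alpha>) * st (M \<delta> \<beta>)))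
        = epsd_up e \<alpha> \<beta> *\<^sub>C 1"
    and R_M_M: "\<And>s \<alpha> \<sigma> \<rho> \<beta>.
        (\<Sum>\<gamma>\<in>UNIV. \<Sum>\<delta>\<in>UNIV. R_du e a s \<rho> \<beta> \<gamma> \<delta> *\<^sub>C (M \<alpha> \<gamma> * st (M \<sigma> \<delta>)))
        = (\<Sum>\<gamma>\<in>UNIV. \<Sum>\<delta>\<in>UNIV. R_du e a s \<delta> \<gamma> \<alpha> \<sigma> *\<^sub>C (st (M \<delta> \<rho>) * M \<gamma> \<beta>))"
    and comult_M: "\<And>\<alpha> \<beta>. \<Delta> (M \<alpha> \<beta>) = (\<Sum>\<gamma>\<in>UNIV. M \<alpha> \<gamma> \<otimes> M \<gamma> \<beta>)"
    and comult_Md: "\<And>\<alpha> \<beta>. \<Delta> (st (M \<alpha> \<beta>)) = (\<Sum>\<gamma>\<in>UNIV. st (M \<alpha> \<gamma>) \<otimes> st (M \<gamma> \<beta>))"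
    and counit_M: "\<And>\<alpha> \<beta>. \<epsilon> (M \<alpha> \<beta>) = kron \<alpha> \<beta>"
    and counit_Md: "\<And>\<alpha> \<beta>. \<epsilon> (st (M \<alpha> \<beta>)) = kron \<alpha> \<beta>"
    and antipode_M: "\<And>\<alpha> \<beta>. S (M \<alpha> \<beta>) =
        (\<Sum>\<gamma>\<in>UNIV. \<Sum>\<delta>\<in>UNIV. (eps_lo e \<alpha> \<gamma> * eps_up e \<delta> \<beta>) *\<^sub>C M \<delta> \<gamma>)"
    and antipode_Md: "\<And>\<alpha> \<beta>. S (st (M \<alpha> \<beta>)) =
        (\<Sum>\<gamma>\<in>UNIV. \<Sum>\<delta>\<in>UNIV. (epsd_lo e \<alpha> \<gamma> * epsd_up e \<delta> \<beta>) *\<^sub>C st (M \<delta> \<gamma>))"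


section \<open>Bispinors and the metric\<close>

definition lin_indep_matrices :: "(4 \<Rightarrow> complex^2^2) \<Rightarrow> bool"
  where "lin_indep_matrices \<sigma> \<longleftrightarrow>
    (\<forall>c :: 4 \<Rightarrow> complex. (\<forall>\<alpha> \<beta>. (\<Sum>I\<in>UNIV. c I * \<sigma> I $ \<alpha> $ \<beta>) = 0) \<longrightarrow> (\<forall>I. c I = 0))"

text \<open>In \<open>\<sigma> I $ \<alpha> $ \<beta>\<close> the second index is dotted, in \<open>sigma_bar e a s \<sigma> I \<alpha> \<beta>\<close> the first one.\<close>

definition sigma_bar ::
  "complex^2^2 \<Rightarrow> real \<Rightarrow> pm \<Rightarrow> (4 \<Rightarrow> complex^2^2) \<Rightarrow> 4 \<Rightarrow> 2 \<Rightarrow> 2 \<Rightarrow> complex"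
  where "sigma_bar e a s \<sigma> I \<alpha> \<beta> =
    (\<Sum>\<kappa>\<in>UNIV. \<Sum>\<tau>\<in>UNIV. \<Sum>\<rho>\<in>UNIV. \<Sum>\<nu>\<in>UNIV.
      epsd_up e \<alpha> \<kappa> * R_ud e a (opp s) \<tau> \<rho> \<kappa> \<nu> * eps_up e \<nu> \<beta> * \<sigma> I $ \<tau> $ \<rho>)"

definition G_metric ::
  "complex^2^2 \<Rightarrow> real \<Rightarrow> pm \<Rightarrow> (4 \<Rightarrow> complex^2^2) \<Rightarrow> complex^4^4"
  where "G_metric e a s \<sigma> = (\<chi> I J. 1 / Q_const a *
    (\<Sum>\<alpha>\<in>UNIV. \<Sum>\<nu>\<in>UNIV. \<Sum>\<beta>\<in>UNIV. \<Sum>\<gamma>\<in>UNIV.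
      eps_up e \<alpha> \<nu> * \<sigma> I $ \<alpha> $ \<beta> * sigma_bar e a s \<sigma> J \<beta> \<gamma> * eps_lo e \<gamma> \<nu>))"

text \<open>The elements \<open>X I\<close> are determined by the \<open>Xs \<alpha> \<beta>\<close> (second index dotted) through
  \<open>Xs \<alpha> \<beta> = X\<^sub>I \<sigma>\<^sup>I\<^sub>\<alpha>\<^sub>\<beta>\<close>; the algebra they generate is the whole type \<open>'b\<close>.\<close>

locale quantum_bispinors = quantum_SL2C e a st \<Delta> \<epsilon> S M
  for e a st \<Delta> \<epsilon> S and M :: "2 \<Rightarrow> 2 \<Rightarrow> 'a::complex_algebra_1" +
  fixes \<sigma> :: "4 \<Rightarrow> complex^2^2"
    and X :: "4 \<Rightarrow> 'b::complex_algebra_1"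
    and Xs :: "2 \<Rightarrow> 2 \<Rightarrow> 'b"
    and \<Delta>\<^sub>L :: "'b \<Rightarrow> ('a, 'b) tensor"
  assumes sigma_indep: "lin_indep_matrices \<sigma>"
    and X_def: "\<And>\<alpha> \<beta>. Xs \<alpha> \<beta> = (\<Sum>I\<in>UNIV. \<sigma> I $ \<alpha> $ \<beta> *\<^sub>C X I)"
    and X_generate: "generated_algebra (range X) = UNIV"
    and coaction: "is_left_coaction \<Delta> \<epsilon> \<Delta>\<^sub>L"
    and coaction_hom: "is_alg_hom \<Delta>\<^sub>L"
    and coaction_X: "\<And>\<alpha> \<beta>. \<Delta>\<^sub>L (Xs \<alpha> \<beta>) =
        (\<Sum>\<tau>\<in>UNIV. \<Sum>\<rho>\<in>UNIV. (M \<alpha> \<tau> * st (M \<beta> \<rho>)) \<otimes> Xs \<tau> \<rho>)"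

end

theory Submission
  imports Defs
begin

text \<open>
  Write \<open>E\<close> for the matrix \<open>\<epsilon>\<^sub>\<alpha>\<^sub>\<beta>\<close>, \<open>F\<close> for its inverse and
  \<open>K = E F\<^sup>T\<close>. Reality of the spinor metric says that the complex conjugate of \<open>E\<close> is \<open>- F\<close>;
  hence \<open>K\<close> is hermitean and \<open>Q = - tr K\<close> is the sum of the \<open>\<bar>\<epsilon>\<^sub>\<alpha>\<^sub>\<beta>\<bar>\<^sup>2\<close>, so that \<open>a > 0\<close>. Put
  \<open>p = a\<^sup>1\<^sup>/\<^sup>2\<close> and \<open>p' = 1 / p\<close> for the upper sign and exchange the two for the lower sign.
  Inserting the definition of the mixed R matrix into \<open>\<sigma>\<close>-bar and cancelling \<open>E\<close> against \<open>F\<close> gives,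
  as matrices, \<open>\<sigma>\<close>-bar \<open>= - (p \<sigma> + p' tr (K \<sigma>) 1)\<close>. Both expressions for the metric then become
  \<open>G\<^sup>I\<^sup>J = - (p tr (K \<sigma>\<^sup>I \<sigma>\<^sup>J) + p' tr (K \<sigma>\<^sup>I) tr (K \<sigma>\<^sup>J)) / Q\<close>,
  from which their equality and the hermiticity of \<open>G\<close> can be read off.

  This formula also gives nondegeneracy. The four \<open>\<sigma>\<close> matrices span all 2 by 2 matrices, and if
  \<open>N\<close> is orthogonal to all of them then \<open>p N + p' tr (K N) 1 = 0\<close>; multiplying by \<open>K\<close> and taking
  traces leaves \<open>p'\<^sup>3 tr (K N) = 0\<close> because \<open>Q = p\<^sup>2 + p'\<^sup>2\<close> and \<open>p p' = 1\<close>, so \<open>N = 0\<close>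
  (lemma \<open>trace_form_radical\<close>).

  For invariance the same bilinear form is written as \<open>F\<close> and \<open>E\<close> contracted with a mixed R
  matrix (lemma \<open>G_metric_eq_form_coeff\<close>). Applying the coaction to the quadratic element puts a
  product \<open>M M\<^sup>\<star> M M\<^sup>\<star>\<close> next to these coefficients. The R matrix commutes the two middle factors;
  then the two undotted generators are adjacent and are absorbed by \<open>F\<close>, and the two dotted ones
  by \<open>E\<close>, and what remains is the original coefficient times the unit
  (lemma \<open>form_coeff_invariant\<close>).
\<close>

section \<open>Quadratic elements under a coaction\<close>

lemma sum_UNIV_prod: "(\<Sum>q\<in>UNIV. f q) = (\<Sum>i\<in>UNIV. \<Sum>j\<in>UNIV. f (i, j))"
  for f :: "'i::finite \<times> 'j::finite \<Rightarrow> 'c::comm_monoid_add"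
  by (simp add: sum.cartesian_product)

lemma sum_swap_pairs:
  "(\<Sum>i\<in>A. \<Sum>k\<in>B. \<Sum>j\<in>C. \<Sum>l\<in>D. f i k j l) = (\<Sum>j\<in>C. \<Sum>l\<in>D. \<Sum>i\<in>A. \<Sum>k\<in>B. f i k j l)"
proof -
  have "(\<Sum>i\<in>A. \<Sum>k\<in>B. \<Sum>j\<in>C. \<Sum>l\<in>D. f i k j l)
      = (\<Sum>i\<in>A. \<Sum>j\<in>C. \<Sum>k\<in>B. \<Sum>l\<in>D. f i k j l)"
    by (rule sum.cong[OF HOL.refl], rule sum.swap)
  also have "\<dots> = (\<Sum>j\<in>C. \<Sum>i\<in>A. \<Sum>k\<in>B. \<Sum>l\<in>D. f i k j l)"
    by (rule sum.swap)
  also have "\<dots> = (\<Sum>j\<in>C. \<Sum>i\<in>A. \<Sum>l\<in>D. \<Sum>k\<in>B. f i k j l)"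
    by (rule sum.cong[OF HOL.refl], rule sum.cong[OF HOL.refl], rule sum.swap)
  also have "\<dots> = (\<Sum>j\<in>C. \<Sum>l\<in>D. \<Sum>i\<in>A. \<Sum>k\<in>B. f i k j l)"
    by (rule sum.cong[OF HOL.refl], rule sum.swap)
  finally show ?thesis .
qed

lemma pure_tensor_zero_right: "x \<otimes> 0 = 0"
  using pure_tensor_scale_right[of x 0 0] by simp

lemma pure_tensor_zero_left: "0 \<otimes> x = 0"
  using pure_tensor_scale_left[of 0 0 x] by simp

lemma pure_tensor_sum_left: "(\<Sum>i\<in>A. f i) \<otimes> y = (\<Sum>i\<in>A. f i \<otimes> y)"
  by (induction A rule: infinite_finite_induct)
    (simp_all add: pure_tensor_zero_left pure_tensor_add_left)

lemma pure_tensor_sum_right: "x \<otimes> (\<Sum>i\<in>A. f i) = (\<Sum>i\<in>A. x \<otimes> f i)"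
  by (induction A rule: infinite_finite_induct)
    (simp_all add: pure_tensor_zero_right pure_tensor_add_right)

text \<open>Multiplicativity of the coaction turns invariance of a quadratic element into an identity for its
  coefficients: they have to be a bilinear form that is invariant under the matrix \<open>N\<close>, where the
  order of the entries of \<open>N\<close> matters.\<close>

lemma invariant_quadratic_element:
  fixes Y :: "'i::finite \<Rightarrow> 'b::complex_algebra_1"
    and N :: "'i \<Rightarrow> 'i \<Rightarrow> 'a::complex_algebra_1"
  assumes D: "is_alg_hom D"
    and D_Y: "\<And>i. D (Y i) = (\<Sum>j\<in>UNIV. N i j \<otimes> Y j)"
    and inv: "\<And>j l. (\<Sum>i\<in>UNIV. \<Sum>k\<in>UNIV. g i k *\<^sub>C (N i j * N k l)) = g j l *\<^sub>C 1"
  shows "D (\<Sum>i\<in>UNIV. \<Sum>k\<in>UNIV. g i k *\<^sub>C (Y i * Y k))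
    = 1 \<otimes> (\<Sum>i\<in>UNIV. \<Sum>k\<in>UNIV. g i k *\<^sub>C (Y i * Y k))"
proof -
  interpret D: Vector_Spaces.linear scaleC scaleC D
    using D by (simp add: is_alg_hom_def)
  have "D (\<Sum>i\<in>UNIV. \<Sum>k\<in>UNIV. g i k *\<^sub>C (Y i * Y k))
      = (\<Sum>i\<in>UNIV. \<Sum>k\<in>UNIV. g i k *\<^sub>C (D (Y i) * D (Y k)))"
    using D by (simp add: D.sum D.scale is_alg_hom_def)
  also have "\<dots> = (\<Sum>i\<in>UNIV. \<Sum>k\<in>UNIV. \<Sum>j\<in>UNIV. \<Sum>l\<in>UNIV.
      (g i k *\<^sub>C (N i j * N k l)) \<otimes> (Y j * Y l))"
    by (simp add: D_Y sum_product tensor_times_pure pure_tensor_scale_left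
        complex_vector.scale_sum_right)
  also have "\<dots> = (\<Sum>j\<in>UNIV. \<Sum>l\<in>UNIV. \<Sum>i\<in>UNIV. \<Sum>k\<in>UNIV.
      (g i k *\<^sub>C (N i j * N k l)) \<otimes> (Y j * Y l))"
    by (rule sum_swap_pairs)
  also have "\<dots> = (\<Sum>j\<in>UNIV. \<Sum>l\<in>UNIV. (g j l *\<^sub>C 1) \<otimes> (Y j * Y l))"
    by (simp only: inv flip: pure_tensor_sum_left)
  also have "\<dots> = 1 \<otimes> (\<Sum>j\<in>UNIV. \<Sum>l\<in>UNIV. g j l *\<^sub>C (Y j * Y l))"
    by (simp add: pure_tensor_sum_right pure_tensor_scale_left pure_tensor_scale_right)
  finally show ?thesis .
qed

lemma quadratic_element_change_generators:
  fixes X :: "'k \<Rightarrow> 'b::complex_algebra_1"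
  assumes "\<And>q. Y q = (\<Sum>I\<in>B. c I q *\<^sub>C X I)"
  shows "(\<Sum>q\<in>A. \<Sum>r\<in>A. g q r *\<^sub>C (Y q * Y r))
    = (\<Sum>I\<in>B. \<Sum>J\<in>B. (\<Sum>q\<in>A. \<Sum>r\<in>A. g q r * (c I q * c J r)) *\<^sub>C (X I * X J))"
proof -
  have "(\<Sum>q\<in>A. \<Sum>r\<in>A. g q r *\<^sub>C (Y q * Y r)) = (\<Sum>q\<in>A. \<Sum>r\<in>A. \<Sum>I\<in>B. \<Sum>J\<in>B.
      (g q r * (c I q * c J r)) *\<^sub>C (X I * X J))"
    by (simp add: assms sum_product complex_vector.scale_sum_right mult_scaleC_left
        mult_scaleC_right scaleC_scaleC mult_ac)
  also have "\<dots> = (\<Sum>I\<in>B. \<Sum>J\<in>B. \<Sum>q\<in>A. \<Sum>r\<in>A. (g q r * (c I q * c J r)) *\<^sub>C (X I * X J))"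
    by (rule sum_swap_pairs)
  finally show ?thesis
    by (simp add: complex_vector.scale_sum_left)
qed


section \<open>The spinor metric\<close>

lemma matrix_inv_cancel:
  fixes A :: "'k::semiring_1^'n^'n"
  assumes "invertible A"
  shows "A ** matrix_inv A = mat 1" and "matrix_inv A ** A = mat 1"
  using someI_ex[OF assms[unfolded invertible_def]] by (simp_all add: matrix_inv_def)

locale spinor_metric_data =
  fixes e :: "complex^2^2" and a :: real
  assumes is_metric: "is_spinor_metric e"
    and is_parameter: "is_R_parameter e a"
begin

text \<open>The trace form \<open>A \<mapsto> tr (K A)\<close> is what remains of the contractions with \<open>\<epsilon>\<^sup>\<alpha>\<^sup>\<nu>\<close> on the left and
  \<open>\<epsilon>\<^sub>\<gamma>\<^sub>\<nu>\<close> on the right.\<close>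

definition K :: "complex^2^2"
  where "K = e ** transpose (matrix_inv e)"

lemma eps_right_inverse: "(\<Sum>\<gamma>\<in>UNIV. eps_lo e \<alpha> \<gamma> * eps_up e \<gamma> \<beta>) = kron \<alpha> \<beta>"
proof -
  have "e ** matrix_inv e = mat 1"
    using is_metric by (simp add: is_spinor_metric_def matrix_inv_cancel)
  then have "(e ** matrix_inv e) $ \<alpha> $ \<beta> = mat 1 $ \<alpha> $ \<beta>" by simp
  then show ?thesis
    by (simp add: matrix_matrix_mult_def mat_def eps_lo_def eps_up_def kron_def)
qed

lemma eps_left_inverse: "(\<Sum>\<gamma>\<in>UNIV. eps_up e \<alpha> \<gamma> * eps_lo e \<gamma> \<beta>) = kron \<alpha> \<beta>"
proof -
  have "matrix_inv e ** e = mat 1"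
    using is_metric by (simp add: is_spinor_metric_def matrix_inv_cancel)
  then have "(matrix_inv e ** e) $ \<alpha> $ \<beta> = mat 1 $ \<alpha> $ \<beta>" by simp
  then show ?thesis
    by (simp add: matrix_matrix_mult_def mat_def eps_lo_def eps_up_def kron_def)
qed

lemma epsd_lo_eq: "epsd_lo e \<beta> \<alpha> = - eps_up e \<alpha> \<beta>"
  and epsd_up_eq: "epsd_up e \<beta> \<alpha> = - eps_lo e \<alpha> \<beta>"
  using is_metric by (simp_all add: is_spinor_metric_def)

lemma cnj_eps_lo: "cnj (eps_lo e \<alpha> \<beta>) = - eps_up e \<alpha> \<beta>"
  and cnj_eps_up: "cnj (eps_up e \<alpha> \<beta>) = - eps_lo e \<alpha> \<beta>"
  using epsd_lo_eq epsd_up_eq by (simp_all add: epsd_lo_def epsd_up_def)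

lemma K_entry: "K $ \<alpha> $ \<beta> = (\<Sum>\<kappa>\<in>UNIV. eps_lo e \<alpha> \<kappa> * eps_up e \<beta> \<kappa>)"
  by (simp add: K_def matrix_matrix_mult_def transpose_def eps_lo_def eps_up_def)

text \<open>The inverse is \<open>E\<^sup>T F\<close>, since \<open>E F\<^sup>T E\<^sup>T F = E (E F)\<^sup>T F\<close>.\<close>

lemma invertible_K: "invertible K"
proof -
  have inv: "e ** matrix_inv e = mat 1"
    using is_metric by (simp add: is_spinor_metric_def matrix_inv_cancel)
  have "K ** (transpose e ** matrix_inv e) = e ** transpose (e ** matrix_inv e) ** matrix_inv e"
    by (simp add: K_def matrix_transpose_mul matrix_mul_assoc)
  also have "\<dots> = mat 1"
    by (simp add: inv transpose_mat)
  finally show ?thesis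
    unfolding invertible_right_inverse by blast
qed

text \<open>Conjugation exchanges \<open>E\<close> and \<open>F\<close> up to sign, and the two signs cancel in \<open>E F\<^sup>T\<close>.\<close>

lemma cnj_K: "cnj (K $ \<alpha> $ \<beta>) = K $ \<beta> $ \<alpha>"
  by (simp add: K_entry cnj_eps_lo cnj_eps_up mult.commute)

lemma trace_K: "trace K = - Q_const a"
  using is_parameter
  by (simp add: is_R_parameter_def Q_const_def trace_def K_entry mult.commute add_eq_0_iff2
      del: of_real_add)

text \<open>Reality of the spinor metric turns \<open>Q\<close> into the sum of all \<open>\<bar>\<epsilon>\<^sub>\<alpha>\<^sub>\<beta>\<bar>\<^sup>2\<close>.\<close>

lemma a_pos: "a > 0"
proof (rule ccontr)
  assume "\<not> a > 0"
  then have "a < 0"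
    using is_parameter by (simp add: is_R_parameter_def)
  then have neg: "a + inverse a < 0"
    by (simp add: add_neg_neg)
  have "eps_up e \<alpha> \<beta> * eps_lo e \<alpha> \<beta> = - complex_of_real ((cmod (eps_lo e \<alpha> \<beta>))\<^sup>2)" for \<alpha> \<beta>
    using cnj_eps_lo[of \<alpha> \<beta>] complex_norm_square[of "eps_lo e \<alpha> \<beta>"]
    by (simp add: mult.commute)
  then have "complex_of_real (a + inverse a) =
      complex_of_real (\<Sum>\<alpha>\<in>UNIV. \<Sum>\<beta>\<in>UNIV. (cmod (eps_lo e \<alpha> \<beta>))\<^sup>2)"
    using is_parameter by (simp add: is_R_parameter_def sum_negf add_eq_0_iff2)
  then have "a + inverse a = (\<Sum>\<alpha>\<in>UNIV. \<Sum>\<beta>\<in>UNIV. (cmod (eps_lo e \<alpha> \<beta>))\<^sup>2)"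
    using of_real_eq_iff by blast
  moreover have "\<dots> \<ge> 0" by (intro sum_nonneg) auto
  ultimately show False using neg by linarith
qed

lemma Q_nonzero: "Q_const a \<noteq> 0"
  using a_pos unfolding Q_const_def of_real_eq_0_iff
  by (metis add_pos_pos less_irrefl positive_imp_inverse_positive)


section \<open>Powers of the parameter\<close>

abbreviation p :: "pm \<Rightarrow> complex"
  where "p s \<equiv> pm_power (sqrt a) s"

lemma p_nonzero: "p s \<noteq> 0"
  using a_pos by (cases s) simp_all

lemma p_opp: "p s * p (opp s) = 1"
  using a_pos by (cases s) (simp_all flip: of_real_mult)

lemma p_pm_power_opp: "p s * pm_power a (opp s) = p (opp s)"
proof -
  have "sqrt a * inverse a = inverse (sqrt a)" "inverse (sqrt a) * a = sqrt a"
    using a_pos real_div_sqrt[of a] by (simp_all add: field_simps)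
  then have "complex_of_real (sqrt a) * complex_of_real (inverse a) = complex_of_real (inverse (sqrt a))"
    "complex_of_real (inverse (sqrt a)) * complex_of_real a = complex_of_real (sqrt a)"
    by (metis of_real_mult)+
  then show ?thesis
    by (cases s) (simp_all only: pm_power.simps opp.simps)
qed

lemma cnj_p: "cnj (p s) = p s"
  by (cases s) simp_all

text \<open>In this form \<open>p (opp s) * Q\<close> reduces by \<open>p s * p (opp s) = 1\<close> to \<open>p s\<close> plus a nonzero term, which is
  what excludes a radical of the metric.\<close>

lemma Q_eq_p: "Q_const a = (p s)\<^sup>2 + (p (opp s))\<^sup>2"
  using a_pos by (cases s)
    (simp_all add: Q_const_def add.commute power_inverse flip: of_real_power of_real_inverse)

lemma opp_opp [simp]: "opp (opp s) = s"
  by (cases s) simp_all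


section \<open>The mixed R matrices and the conjugate bispinors\<close>

lemma sum_kron: "(\<Sum>\<beta>\<in>UNIV. kron \<alpha> \<beta> * f \<beta>) = f \<alpha>" "(\<Sum>\<beta>\<in>UNIV. f \<beta> * kron \<beta> \<alpha>) = f \<alpha>"
  by (simp_all add: kron_def if_distrib if_distribR cong: if_cong)

lemma kron_commute: "kron \<alpha> \<beta> = kron \<beta> \<alpha>"
  by (simp add: kron_def)

lemma R_du_eq: "R_du e a s \<delta> \<gamma> \<alpha> \<sigma> =
    p s * (kron \<gamma> \<delta> * kron \<alpha> \<sigma>) + p (opp s) * (eps_up e \<gamma> \<sigma> * eps_lo e \<delta> \<alpha>)"
  using kron_commute[of \<sigma> \<alpha>]
  by (simp add: R_du_def R_mat_def algebra_simps flip: p_pm_power_opp[of s])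

lemma R_ud_eq: "R_ud e a (opp s) \<gamma> \<delta> \<sigma> \<alpha> =
    p s * (eps_lo e \<delta> \<alpha> * eps_up e \<gamma> \<sigma>)
    + p (opp s) * (K $ \<delta> $ \<gamma> * (\<Sum>\<nu>\<in>UNIV. eps_lo e \<nu> \<alpha> * eps_up e \<nu> \<sigma>))"
proof -
  have 1: "(\<Sum>\<kappa>\<in>UNIV. \<Sum>\<nu>\<in>UNIV. eps_lo e \<delta> \<kappa> * (kron \<gamma> \<nu> * kron \<kappa> \<alpha>) * eps_up e \<nu> \<sigma>)
      = eps_lo e \<delta> \<alpha> * eps_up e \<gamma> \<sigma>"
  proof -
    have "(\<Sum>\<kappa>\<in>UNIV. \<Sum>\<nu>\<in>UNIV. eps_lo e \<delta> \<kappa> * (kron \<gamma> \<nu> * kron \<kappa> \<alpha>) * eps_up e \<nu> \<sigma>)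
      = (\<Sum>\<kappa>\<in>UNIV. eps_lo e \<delta> \<kappa> * kron \<kappa> \<alpha>) * (\<Sum>\<nu>\<in>UNIV. kron \<gamma> \<nu> * eps_up e \<nu> \<sigma>)"
      by (simp add: sum_product mult_ac)
    then show ?thesis by (simp only: sum_kron)
  qed
  have 2: "(\<Sum>\<kappa>\<in>UNIV. \<Sum>\<nu>\<in>UNIV.
      eps_lo e \<delta> \<kappa> * (c * eps_up e \<gamma> \<kappa> * eps_lo e \<nu> \<alpha>) * eps_up e \<nu> \<sigma>)
      = c * (K $ \<delta> $ \<gamma> * (\<Sum>\<nu>\<in>UNIV. eps_lo e \<nu> \<alpha> * eps_up e \<nu> \<sigma>))" for c
    by (simp add: K_entry sum_product sum_distrib_left mult_ac)
  show ?thesis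
    unfolding R_ud_def R_mat_def distrib_left distrib_right sum.distrib 1 2 opp_opp
    by (simp add: p_pm_power_opp flip: mult.assoc)
qed

text \<open>The first term of the mixed R matrix returns \<open>\<sigma>\<close> itself: \<open>F\<close> on one index and \<open>E\<close> on the other
  cancel the spinor metrics that raise the indices of \<open>\<sigma>\<close>-bar. In the second term all free indices sit on
  \<open>E\<^sup>T F\<^sup>T E F = 1\<close>, and \<open>\<sigma>\<close> is contracted to a trace. The overall sign comes from
  \<open>epsd_up e \<beta> \<alpha> = - eps_lo e \<alpha> \<beta>\<close>.\<close>

lemma sigma_bar_eq: "sigma_bar e a s \<sigma> I \<alpha> \<beta> =
    - (p s * \<sigma> I $ \<alpha> $ \<beta> + p (opp s) * trace (K ** \<sigma> I) * kron \<alpha> \<beta>)"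
proof -
  have 1: "(\<Sum>\<kappa>\<in>UNIV. \<Sum>\<tau>\<in>UNIV. \<Sum>\<rho>\<in>UNIV. \<Sum>\<nu>\<in>UNIV.
        eps_lo e \<kappa> \<alpha> * (p s * (eps_lo e \<rho> \<nu> * eps_up e \<tau> \<kappa>)) * eps_up e \<nu> \<beta> * \<sigma> I $ \<tau> $ \<rho>)
      = p s * \<sigma> I $ \<alpha> $ \<beta>" (is "?l = _")
  proof -
    have "?l = p s * (\<Sum>\<rho>\<in>UNIV. (\<Sum>\<tau>\<in>UNIV. (\<Sum>\<kappa>\<in>UNIV. eps_up e \<tau> \<kappa> * eps_lo e \<kappa> \<alpha>) * \<sigma> I $ \<tau> $ \<rho>)
         * (\<Sum>\<nu>\<in>UNIV. eps_lo e \<rho> \<nu> * eps_up e \<nu> \<beta>))"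
      by (simp add: sum_2 algebra_simps)
    also have "\<dots> = p s * \<sigma> I $ \<alpha> $ \<beta>"
      by (simp only: eps_left_inverse eps_right_inverse sum_kron kron_commute[of _ \<alpha>])
    finally show ?thesis .
  qed
  have 2: "(\<Sum>\<kappa>\<in>UNIV. \<Sum>\<tau>\<in>UNIV. \<Sum>\<rho>\<in>UNIV. \<Sum>\<nu>\<in>UNIV.
        eps_lo e \<kappa> \<alpha> * (p (opp s) * (K $ \<rho> $ \<tau> * (\<Sum>\<mu>\<in>UNIV. eps_lo e \<mu> \<nu> * eps_up e \<mu> \<kappa>)))
          * eps_up e \<nu> \<beta> * \<sigma> I $ \<tau> $ \<rho>)
      = p (opp s) * trace (K ** \<sigma> I) * kron \<alpha> \<beta>" (is "?l = _")
  proof -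
    have "?l = p (opp s) * trace (K ** \<sigma> I) *
        (\<Sum>\<mu>\<in>UNIV. (\<Sum>\<kappa>\<in>UNIV. eps_up e \<mu> \<kappa> * eps_lo e \<kappa> \<alpha>)
          * (\<Sum>\<nu>\<in>UNIV. eps_lo e \<mu> \<nu> * eps_up e \<nu> \<beta>))"
      by (simp add: sum_2 algebra_simps trace_def matrix_matrix_mult_def)
    also have "\<dots> = p (opp s) * trace (K ** \<sigma> I) * kron \<alpha> \<beta>"
      by (simp only: eps_left_inverse eps_right_inverse sum_kron kron_commute[of _ \<alpha>])
    finally show ?thesis .
  qed
  have "sigma_bar e a s \<sigma> I \<alpha> \<beta> = - (\<Sum>\<kappa>\<in>UNIV. \<Sum>\<tau>\<in>UNIV. \<Sum>\<rho>\<in>UNIV. \<Sum>\<nu>\<in>UNIV.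
      eps_lo e \<kappa> \<alpha> * R_ud e a (opp s) \<tau> \<rho> \<kappa> \<nu> * eps_up e \<nu> \<beta> * \<sigma> I $ \<tau> $ \<rho>)"
    by (simp add: sigma_bar_def epsd_up_eq sum_negf)
  then show ?thesis
    unfolding R_ud_eq distrib_left distrib_right sum.distrib 1 2 by simp
qed


section \<open>The metric\<close>

lemma G_metric_eq: "G_metric e a s \<sigma> $ I $ J = - (1 / Q_const a) *
    (p s * trace (K ** \<sigma> I ** \<sigma> J) + p (opp s) * trace (K ** \<sigma> I) * trace (K ** \<sigma> J))"
proof -
  have "(\<Sum>\<alpha>\<in>UNIV. \<Sum>\<nu>\<in>UNIV. \<Sum>\<beta>\<in>UNIV. \<Sum>\<gamma>\<in>UNIV.
        eps_up e \<alpha> \<nu> * \<sigma> I $ \<alpha> $ \<beta> * B \<beta> \<gamma> * eps_lo e \<gamma> \<nu>)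
      = (\<Sum>\<alpha>\<in>UNIV. \<Sum>\<beta>\<in>UNIV. \<Sum>\<gamma>\<in>UNIV. K $ \<gamma> $ \<alpha> * \<sigma> I $ \<alpha> $ \<beta> * B \<beta> \<gamma>)" for B
    by (simp add: K_entry sum_2 algebra_simps)
  moreover have "(\<Sum>\<alpha>\<in>UNIV. \<Sum>\<beta>\<in>UNIV. \<Sum>\<gamma>\<in>UNIV. K $ \<gamma> $ \<alpha> * \<sigma> I $ \<alpha> $ \<beta> * sigma_bar e a s \<sigma> J \<beta> \<gamma>)
      = - (p s * trace (K ** \<sigma> I ** \<sigma> J) + p (opp s) * trace (K ** \<sigma> I) * trace (K ** \<sigma> J))"
    unfolding sigma_bar_eq
    by (simp add: sum_2 trace_def matrix_matrix_mult_def kron_def algebra_simps)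
  ultimately show ?thesis
    by (simp only: G_metric_def vec_lambda_beta mult_minus_left mult_minus_right)
qed

text \<open>The dotted spinor metrics contribute two minus signs and the same matrix \<open>K\<close>, so this is
  \<open>tr (K B \<sigma>\<^sup>J)\<close> with \<open>B\<close> the conjugate bispinor of \<open>\<sigma>\<^sup>I\<close>. Since \<open>B\<close> is a combination of \<open>\<sigma>\<^sup>I\<close> and the
  unit matrix, it does not matter on which of the two factors the bar is put.\<close>

lemma G_metric_dotted: "G_metric e a s \<sigma> $ I $ J = 1 / Q_const a *
    (\<Sum>\<nu>\<in>UNIV. \<Sum>\<gamma>\<in>UNIV. \<Sum>\<alpha>\<in>UNIV. \<Sum>\<beta>\<in>UNIV.
      epsd_lo e \<nu> \<gamma> * sigma_bar e a s \<sigma> I \<gamma> \<alpha> * \<sigma> J $ \<alpha> $ \<beta> * epsd_up e \<nu> \<beta>)"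
proof -
  have "(\<Sum>\<nu>\<in>UNIV. \<Sum>\<gamma>\<in>UNIV. \<Sum>\<alpha>\<in>UNIV. \<Sum>\<beta>\<in>UNIV.
        epsd_lo e \<nu> \<gamma> * B \<gamma> \<alpha> * \<sigma> J $ \<alpha> $ \<beta> * epsd_up e \<nu> \<beta>)
      = (\<Sum>\<alpha>\<in>UNIV. \<Sum>\<beta>\<in>UNIV. \<Sum>\<gamma>\<in>UNIV. K $ \<beta> $ \<gamma> * B \<gamma> \<alpha> * \<sigma> J $ \<alpha> $ \<beta>)" for B
    unfolding epsd_lo_eq epsd_up_eq by (simp add: K_entry sum_2 algebra_simps)
  moreover have "(\<Sum>\<alpha>\<in>UNIV. \<Sum>\<beta>\<in>UNIV. \<Sum>\<gamma>\<in>UNIV. K $ \<beta> $ \<gamma> * sigma_bar e a s \<sigma> I \<gamma> \<alpha> * \<sigma> J $ \<alpha> $ \<beta>)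
      = - (p s * trace (K ** \<sigma> I ** \<sigma> J) + p (opp s) * trace (K ** \<sigma> I) * trace (K ** \<sigma> J))"
    unfolding sigma_bar_eq
    by (simp add: sum_2 trace_def matrix_matrix_mult_def kron_def algebra_simps)
  ultimately show ?thesis
    by (simp only: G_metric_eq mult_minus_left mult_minus_right)
qed

text \<open>Conjugating the trace of a product of hermitean matrices reverses the order of the factors, and
  cyclicity restores \<open>K\<close> to the front.\<close>

lemma G_metric_hermitean:
  assumes herm: "\<And>I \<alpha> \<beta>. cnj (\<sigma> I $ \<alpha> $ \<beta>) = \<sigma> I $ \<beta> $ \<alpha>"
  shows "cnj (G_metric e a s \<sigma> $ I $ J) = G_metric e a s \<sigma> $ J $ I"
proof -
  have 1: "cnj (trace (K ** \<sigma> I)) = trace (K ** \<sigma> I)" for I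
    by (simp add: trace_def matrix_matrix_mult_def herm cnj_K sum_2 algebra_simps)
  have 2: "cnj (trace (K ** \<sigma> I ** \<sigma> J)) = trace (K ** \<sigma> J ** \<sigma> I)"
    by (simp add: trace_def matrix_matrix_mult_def herm cnj_K sum_2 algebra_simps)
  have 3: "cnj (Q_const a) = Q_const a"
    by (simp add: Q_const_def)
  show ?thesis
    by (simp add: G_metric_eq 1 2 3 cnj_p mult.commute mult.left_commute)
qed


section \<open>Nondegeneracy\<close>

text \<open>Four linearly independent elements of a space of dimension four; the entries of a matrix are
  indexed by \<open>2 \<times> 2\<close> so that the dimension count is available for vectors.\<close>

lemma lin_indep_matrices_span:
  fixes \<sigma> :: "4 \<Rightarrow> complex^2^2"
  assumes "lin_indep_matrices \<sigma>"
  obtains c where "A = (\<chi> \<alpha> \<beta>. \<Sum>I\<in>UNIV. c I * \<sigma> I $ \<alpha> $ \<beta>)"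
proof -
  define P :: "complex^4^(2 \<times> 2)" where "P = (\<chi> q I. \<sigma> I $ fst q $ snd q)"
  have "inj ((*v) P)"
  proof (subst vec.inj_iff_eq_0, intro allI impI)
    fix x assume "P *v x = 0"
    then have "(\<Sum>I\<in>UNIV. x $ I * \<sigma> I $ \<alpha> $ \<beta>) = 0" for \<alpha> \<beta>
      by (auto simp: vec_eq_iff matrix_vector_mult_def P_def mult.commute)
    then show "x = 0"
      using assms by (simp add: lin_indep_matrices_def vec_eq_iff)
  qed
  then have "surj ((*v) P)"
    by (intro vec.linear_injective_imp_surjective matrix_vector_mul_linear_gen)
      (simp_all add: card_cart_basis)
  then obtain x where "P *v x = (\<chi> q. A $ fst q $ snd q)"
    by (metis surjD)
  then have "A = (\<chi> \<alpha> \<beta>. \<Sum>I\<in>UNIV. x $ I * \<sigma> I $ \<alpha> $ \<beta>)"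
    by (simp add: vec_eq_iff matrix_vector_mult_def P_def mult.commute)
  then show ?thesis by (rule that)
qed

text \<open>As \<open>K\<close> is invertible, \<open>K A\<close> runs through all matrices, so \<open>N\<close> must be the multiple
  \<open>- p (opp s) / p s * tr (K N)\<close> of the unit matrix. Taking the trace against \<open>K\<close> once more, with
  \<open>tr K = - Q\<close>, forces this multiple to vanish.\<close>

lemma trace_form_radical:
  fixes N :: "complex^2^2"
  assumes "\<And>A. p s * trace (K ** A ** N) + p (opp s) * trace (K ** A) * trace (K ** N) = 0"
  shows "N = 0"
proof -
  define t where "t = trace (K ** N)"
  \<comment> \<open>Choosing \<open>A\<close> so that \<open>K A\<close> is a matrix unit extracts a single entry.\<close>
  have ortho: "p s * N $ \<alpha> $ \<beta> + p (opp s) * t * kron \<alpha> \<beta> = 0" for \<alpha> \<beta>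
  proof -
    define U :: "complex^2^2" where "U = (\<chi> i j. kron i \<beta> * kron j \<alpha>)"
    have KU: "K ** (matrix_inv K ** U) = U"
      by (simp add: matrix_mul_assoc matrix_inv_cancel invertible_K)
    have "trace (U ** N) = N $ \<alpha> $ \<beta>" "trace U = kron \<alpha> \<beta>"
      using exhaust_2[of \<alpha>] exhaust_2[of \<beta>]
      by (auto simp: U_def trace_def matrix_matrix_mult_def sum_2 kron_def)
    then show ?thesis
      using assms[of "matrix_inv K ** U"] by (simp add: KU t_def mult_ac)
  qed
  have "p s * t + p (opp s) * t * trace K
      = (\<Sum>\<alpha>\<in>UNIV. \<Sum>\<beta>\<in>UNIV. K $ \<alpha> $ \<beta> * (p s * N $ \<beta> $ \<alpha> + p (opp s) * t * kron \<beta> \<alpha>))"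
    by (simp add: t_def trace_def matrix_matrix_mult_def sum_2 kron_def algebra_simps)
  also have "\<dots> = 0" by (simp add: ortho)
  finally have "t * (p s - p (opp s) * ((p s)\<^sup>2 + (p (opp s))\<^sup>2)) = 0"
    by (simp add: trace_K Q_eq_p[of s] algebra_simps)
  moreover have "p s - p (opp s) * ((p s)\<^sup>2 + (p (opp s))\<^sup>2) = - ((p (opp s)) ^ 3)"
    using p_opp[of s] by algebra
  ultimately have "t = 0" using p_nonzero by simp
  then show ?thesis
    using ortho p_nonzero by (simp add: vec_eq_iff)
qed

lemma invertible_G_metric:
  assumes "lin_indep_matrices \<sigma>"
  shows "invertible (G_metric e a s \<sigma>)"
proof -
  have "c = 0" if c: "G_metric e a s \<sigma> *v c = 0" for c
  proof -
    define N where "N = (\<chi> \<alpha> \<beta>. \<Sum>J\<in>UNIV. c $ J * \<sigma> J $ \<alpha> $ \<beta>)"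
    define B where "B A C = p s * trace (K ** A ** C) + p (opp s) * trace (K ** A) * trace (K ** C)"
      for A C :: "complex^2^2"
    have B_sum_right: "B A (\<chi> \<alpha> \<beta>. \<Sum>J\<in>UNIV. d J * \<sigma> J $ \<alpha> $ \<beta>) = (\<Sum>J\<in>UNIV. d J * B A (\<sigma> J))" for A d
      by (simp add: B_def trace_def matrix_matrix_mult_def sum_2 sum.distrib sum_distrib_left
          algebra_simps)
    have B_sum_left: "B (\<chi> \<alpha> \<beta>. \<Sum>I\<in>UNIV. d I * \<sigma> I $ \<alpha> $ \<beta>) C = (\<Sum>I\<in>UNIV. d I * B (\<sigma> I) C)" for C d
      by (simp add: B_def trace_def matrix_matrix_mult_def sum_2 sum.distrib sum_distrib_left
          algebra_simps)
    have "B (\<sigma> I) N = 0" for I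
    proof -
      have "(\<Sum>J\<in>UNIV. G_metric e a s \<sigma> $ I $ J * c $ J) = 0"
        using c by (simp add: vec_eq_iff matrix_vector_mult_def)
      then have "- (1 / Q_const a) * B (\<sigma> I) N = 0"
        unfolding N_def B_sum_right G_metric_eq B_def[symmetric]
        by (simp add: sum_distrib_left mult_ac)
      then show ?thesis using Q_nonzero by simp
    qed
    then have "B A N = 0" for A
    proof -
      obtain d where "A = (\<chi> \<alpha> \<beta>. \<Sum>I\<in>UNIV. d I * \<sigma> I $ \<alpha> $ \<beta>)"
        using lin_indep_matrices_span[OF assms] .
      with \<open>\<And>I. B (\<sigma> I) N = 0\<close> show ?thesis by (simp add: B_sum_left)
    qed
    then have "N = 0"
      unfolding B_def by (rule trace_form_radical)
    then show "c = 0"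
      using assms by (simp add: N_def lin_indep_matrices_def vec_eq_iff)
  qed
  then show ?thesis
    by (simp add: invertible_left_inverse matrix_left_invertible_ker)
qed

end


section \<open>Invariance\<close>

context spinor_metric_data
begin

text \<open>The coefficients of the metric with respect to the \<open>X\<^sub>\<alpha>\<^sub>\<beta>\<close>, arranged so that the mixed R matrix
  carries exactly the indices \<open>\<beta>\<close> and \<open>\<gamma>\<close> of the two factors that have to be commuted.\<close>

definition form_coeff :: "pm \<Rightarrow> 2 \<times> 2 \<Rightarrow> 2 \<times> 2 \<Rightarrow> complex"
  where "form_coeff s = (\<lambda>(\<alpha>, \<beta>) (\<gamma>, \<delta>). - (1 / Q_const a) *
    (\<Sum>\<kappa>\<in>UNIV. \<Sum>\<mu>\<in>UNIV. eps_up e \<alpha> \<kappa> * eps_lo e \<delta> \<mu> * R_du e a s \<beta> \<gamma> \<kappa> \<mu>))"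

lemma G_metric_eq_form_coeff: "G_metric e a s \<sigma> $ I $ J =
  (\<Sum>q\<in>UNIV. \<Sum>r\<in>UNIV. form_coeff s q r * (\<sigma> I $ fst q $ snd q * \<sigma> J $ fst r $ snd r))"
proof -
  have "(\<Sum>\<kappa>\<in>UNIV. \<Sum>\<mu>\<in>UNIV. eps_up e \<alpha> \<kappa> * eps_lo e \<delta> \<mu> * R_du e a s \<beta> \<gamma> \<kappa> \<mu>)
      = p s * (K $ \<delta> $ \<alpha> * kron \<gamma> \<beta>) + p (opp s) * (K $ \<beta> $ \<alpha> * K $ \<delta> $ \<gamma>)" for \<alpha> \<beta> \<gamma> \<delta>
    unfolding R_du_eq by (simp add: K_entry sum_2 kron_def algebra_simps)
  then have "form_coeff s (\<alpha>, \<beta>) (\<gamma>, \<delta>) = - (1 / Q_const a) *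
      (p s * (K $ \<delta> $ \<alpha> * kron \<gamma> \<beta>) + p (opp s) * (K $ \<beta> $ \<alpha> * K $ \<delta> $ \<gamma>))" for \<alpha> \<beta> \<gamma> \<delta>
    by (simp only: form_coeff_def prod.case)
  then have "(\<Sum>q\<in>UNIV. \<Sum>r\<in>UNIV. form_coeff s q r * (\<sigma> I $ fst q $ snd q * \<sigma> J $ fst r $ snd r))
      = - (1 / Q_const a) * (\<Sum>\<alpha>\<in>UNIV. \<Sum>\<beta>\<in>UNIV. \<Sum>\<gamma>\<in>UNIV. \<Sum>\<delta>\<in>UNIV.
          (p s * (K $ \<delta> $ \<alpha> * kron \<gamma> \<beta>) + p (opp s) * (K $ \<beta> $ \<alpha> * K $ \<delta> $ \<gamma>))
            * (\<sigma> I $ \<alpha> $ \<beta> * \<sigma> J $ \<gamma> $ \<delta>))"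
    by (simp only: sum_UNIV_prod fst_conv snd_conv sum_distrib_left mult.assoc)
  also have "\<dots> = G_metric e a s \<sigma> $ I $ J"
    unfolding G_metric_eq
    by (simp add: sum_2 trace_def matrix_matrix_mult_def kron_def algebra_simps)
  finally show ?thesis ..
qed

end

sublocale quantum_SL2C \<subseteq> spinor_metric_data e a
  by unfold_locales (rule spinor_metric R_parameter)+

text \<open>The next two lemmas only rearrange finite sums, before and after the middle factors of a
  fourfold product are commuted; the order of the factors is kept.\<close>

lemma group_middle_factors:
  fixes u v w z :: "'i::finite \<Rightarrow> 'a::complex_algebra_1" and f g :: "'i \<Rightarrow> 'j::finite \<Rightarrow> complex"
  shows "(\<Sum>\<alpha>\<in>UNIV. \<Sum>\<beta>\<in>UNIV. \<Sum>\<gamma>\<in>UNIV. \<Sum>\<delta>\<in>UNIV.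
      (\<Sum>\<kappa>\<in>UNIV. \<Sum>\<mu>\<in>UNIV. f \<alpha> \<kappa> * g \<delta> \<mu> * r \<beta> \<gamma> \<kappa> \<mu>) *\<^sub>C (u \<alpha> * v \<beta> * (w \<gamma> * z \<delta>)))
    = (\<Sum>\<alpha>\<in>UNIV. \<Sum>\<delta>\<in>UNIV. \<Sum>\<kappa>\<in>UNIV. \<Sum>\<mu>\<in>UNIV. (f \<alpha> \<kappa> * g \<delta> \<mu>) *\<^sub>C
        (u \<alpha> * (\<Sum>\<gamma>\<in>UNIV. \<Sum>\<beta>\<in>UNIV. r \<beta> \<gamma> \<kappa> \<mu> *\<^sub>C (v \<beta> * w \<gamma>)) * z \<delta>))"
    (is "?l = ?r")
proof -
  have "?l = (\<Sum>(\<alpha>, \<beta>, \<gamma>, \<delta>, \<kappa>, \<mu>)\<in>UNIV.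
      (f \<alpha> \<kappa> * g \<delta> \<mu> * r \<beta> \<gamma> \<kappa> \<mu>) *\<^sub>C (u \<alpha> * v \<beta> * w \<gamma> * z \<delta>))"
    by (simp add: sum_UNIV_prod complex_vector.scale_sum_left mult.assoc)
  also have "\<dots> = (\<Sum>(\<alpha>, \<delta>, \<kappa>, \<mu>, \<gamma>, \<beta>)\<in>UNIV.
      (f \<alpha> \<kappa> * g \<delta> \<mu> * r \<beta> \<gamma> \<kappa> \<mu>) *\<^sub>C (u \<alpha> * v \<beta> * w \<gamma> * z \<delta>))"
    by (rule sum.reindex_bij_witness[where
          i = "\<lambda>(\<alpha>, \<delta>, \<kappa>, \<mu>, \<gamma>, \<beta>). (\<alpha>, \<beta>, \<gamma>, \<delta>, \<kappa>, \<mu>)" and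
          j = "\<lambda>(\<alpha>, \<beta>, \<gamma>, \<delta>, \<kappa>, \<mu>). (\<alpha>, \<delta>, \<kappa>, \<mu>, \<gamma>, \<beta>)"]) auto
  also have "\<dots> = ?r"
    by (simp add: sum_UNIV_prod sum_distrib_left sum_distrib_right complex_vector.scale_sum_right
        mult_scaleC_left mult_scaleC_right scaleC_scaleC mult.assoc)
  finally show ?thesis .
qed

lemma group_outer_factors:
  fixes u z :: "'i::finite \<Rightarrow> 'a::complex_algebra_1" and v w :: "'i \<Rightarrow> 'i \<Rightarrow> 'a"
  shows "(\<Sum>\<alpha>\<in>UNIV. \<Sum>\<delta>\<in>UNIV. \<Sum>\<kappa>\<in>UNIV. \<Sum>\<mu>\<in>UNIV. (f \<alpha> \<kappa> * g \<delta> \<mu>) *\<^sub>C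
        (u \<alpha> * (\<Sum>\<gamma>\<in>UNIV. \<Sum>\<beta>\<in>UNIV. r \<gamma> \<beta> *\<^sub>C (v \<kappa> \<gamma> * w \<mu> \<beta>)) * z \<delta>))
    = (\<Sum>\<gamma>\<in>UNIV. \<Sum>\<beta>\<in>UNIV. r \<gamma> \<beta> *\<^sub>C
        ((\<Sum>\<alpha>\<in>UNIV. \<Sum>\<kappa>\<in>UNIV. f \<alpha> \<kappa> *\<^sub>C (u \<alpha> * v \<kappa> \<gamma>)) *
         (\<Sum>\<delta>\<in>UNIV. \<Sum>\<mu>\<in>UNIV. g \<delta> \<mu> *\<^sub>C (w \<mu> \<beta> * z \<delta>))))"
    (is "?l = ?r")
proof -
  have "?l = (\<Sum>(\<alpha>, \<delta>, \<kappa>, \<mu>, \<gamma>, \<beta>)\<in>UNIV.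
      (f \<alpha> \<kappa> * g \<delta> \<mu> * r \<gamma> \<beta>) *\<^sub>C (u \<alpha> * v \<kappa> \<gamma> * w \<mu> \<beta> * z \<delta>))"
    by (simp add: sum_UNIV_prod sum_distrib_left sum_distrib_right complex_vector.scale_sum_right
        mult_scaleC_left mult_scaleC_right scaleC_scaleC mult.assoc)
  also have "\<dots> = (\<Sum>(\<gamma>, \<beta>, \<delta>, \<mu>, \<alpha>, \<kappa>)\<in>UNIV.
      (r \<gamma> \<beta> * g \<delta> \<mu> * f \<alpha> \<kappa>) *\<^sub>C (u \<alpha> * v \<kappa> \<gamma> * w \<mu> \<beta> * z \<delta>))"
    by (rule sum.reindex_bij_witness[where
          i = "\<lambda>(\<gamma>, \<beta>, \<delta>, \<mu>, \<alpha>, \<kappa>). (\<alpha>, \<delta>, \<kappa>, \<mu>, \<gamma>, \<beta>)" and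
          j = "\<lambda>(\<alpha>, \<delta>, \<kappa>, \<mu>, \<gamma>, \<beta>). (\<gamma>, \<beta>, \<delta>, \<mu>, \<alpha>, \<kappa>)"]) (auto simp: mult_ac)
  also have "\<dots> = ?r"
    by (simp add: sum_UNIV_prod sum_distrib_left sum_distrib_right complex_vector.scale_sum_right
        mult_scaleC_left mult_scaleC_right scaleC_scaleC mult.assoc)
  finally show ?thesis .
qed

text \<open>Replacing \<open>R M\<^sup>\<star> M\<close> by \<open>M M\<^sup>\<star> R\<close> in the middle brings the two undotted generators together, where
  \<open>F\<close> absorbs them, and likewise the two dotted ones, where \<open>E\<close> does.\<close>

lemma (in quantum_SL2C) form_coeff_invariant:
  fixes s
  defines "N \<equiv> \<lambda>(\<alpha>, \<beta>) (\<tau>, \<rho>). M \<alpha> \<tau> * st (M \<beta> \<rho>)"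
  shows "(\<Sum>i\<in>UNIV. \<Sum>k\<in>UNIV. form_coeff s i k *\<^sub>C (N i j * N k l)) = form_coeff s j l *\<^sub>C 1"
proof -
  obtain \<tau> \<rho> \<mu> \<nu> where jl: "j = (\<tau>, \<rho>)" "l = (\<mu>, \<nu>)" by fastforce
  let ?F = "eps_up e" and ?E = "eps_lo e" and ?R = "R_du e a s"
  \<comment> \<open>The dotted upper metric is minus the transpose of \<open>E\<close>, hence the order of the dotted generators.\<close>
  have lo: "(\<Sum>\<delta>\<in>UNIV. \<Sum>\<kappa>\<in>UNIV. ?E \<delta> \<kappa> *\<^sub>C (st (M \<kappa> \<kappa>') * st (M \<delta> \<nu>))) = ?E \<nu> \<kappa>' *\<^sub>C 1" for \<kappa>'
    using epsd_up_M_M[of \<kappa>' \<nu>]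
    by (simp add: epsd_up_eq sum_negf sum_2 add_ac flip: minus_add_distrib)
  have "(\<Sum>\<alpha>\<in>UNIV. \<Sum>\<beta>\<in>UNIV. \<Sum>\<gamma>\<in>UNIV. \<Sum>\<delta>\<in>UNIV.
        (\<Sum>\<kappa>\<in>UNIV. \<Sum>\<kappa>'\<in>UNIV. ?F \<alpha> \<kappa> * ?E \<delta> \<kappa>' * ?R \<beta> \<gamma> \<kappa> \<kappa>') *\<^sub>C
          (M \<alpha> \<tau> * st (M \<beta> \<rho>) * (M \<gamma> \<mu> * st (M \<delta> \<nu>))))
      = (\<Sum>\<alpha>\<in>UNIV. \<Sum>\<delta>\<in>UNIV. \<Sum>\<kappa>\<in>UNIV. \<Sum>\<kappa>'\<in>UNIV. (?F \<alpha> \<kappa> * ?E \<delta> \<kappa>') *\<^sub>C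
          (M \<alpha> \<tau> * (\<Sum>\<gamma>\<in>UNIV. \<Sum>\<beta>\<in>UNIV. ?R \<beta> \<gamma> \<kappa> \<kappa>' *\<^sub>C (st (M \<beta> \<rho>) * M \<gamma> \<mu>)) * st (M \<delta> \<nu>)))"
    by (rule group_middle_factors)
  also have "\<dots> = (\<Sum>\<alpha>\<in>UNIV. \<Sum>\<delta>\<in>UNIV. \<Sum>\<kappa>\<in>UNIV. \<Sum>\<kappa>'\<in>UNIV. (?F \<alpha> \<kappa> * ?E \<delta> \<kappa>') *\<^sub>C
          (M \<alpha> \<tau> * (\<Sum>\<gamma>\<in>UNIV. \<Sum>\<delta>\<in>UNIV. ?R \<rho> \<mu> \<gamma> \<delta> *\<^sub>C (M \<kappa> \<gamma> * st (M \<kappa>' \<delta>))) * st (M \<delta> \<nu>)))"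
    by (simp only: R_M_M)
  also have "\<dots> = (\<Sum>\<gamma>\<in>UNIV. \<Sum>\<delta>'\<in>UNIV. ?R \<rho> \<mu> \<gamma> \<delta>' *\<^sub>C
        ((\<Sum>\<alpha>\<in>UNIV. \<Sum>\<kappa>\<in>UNIV. ?F \<alpha> \<kappa> *\<^sub>C (M \<alpha> \<tau> * M \<kappa> \<gamma>)) *
         (\<Sum>\<delta>\<in>UNIV. \<Sum>\<kappa>'\<in>UNIV. ?E \<delta> \<kappa>' *\<^sub>C (st (M \<kappa>' \<delta>') * st (M \<delta> \<nu>)))))"
    by (rule group_outer_factors)
  also have "\<dots> = (\<Sum>\<kappa>\<in>UNIV. \<Sum>\<kappa>'\<in>UNIV. ?F \<tau> \<kappa> * ?E \<nu> \<kappa>' * ?R \<rho> \<mu> \<kappa> \<kappa>') *\<^sub>C 1"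
    unfolding eps_up_M_M lo
    by (simp add: mult_scaleC_left mult_scaleC_right scaleC_scaleC complex_vector.scale_sum_left mult_ac)
  finally have eq: "(\<Sum>\<alpha>\<in>UNIV. \<Sum>\<beta>\<in>UNIV. \<Sum>\<gamma>\<in>UNIV. \<Sum>\<delta>\<in>UNIV.
        (\<Sum>\<kappa>\<in>UNIV. \<Sum>\<kappa>'\<in>UNIV. ?F \<alpha> \<kappa> * ?E \<delta> \<kappa>' * ?R \<beta> \<gamma> \<kappa> \<kappa>') *\<^sub>C
          (M \<alpha> \<tau> * st (M \<beta> \<rho>) * (M \<gamma> \<mu> * st (M \<delta> \<nu>))))
      = (\<Sum>\<kappa>\<in>UNIV. \<Sum>\<kappa>'\<in>UNIV. ?F \<tau> \<kappa> * ?E \<nu> \<kappa>' * ?R \<rho> \<mu> \<kappa> \<kappa>') *\<^sub>C 1" (is "?l = _") .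
  have "(\<Sum>i\<in>UNIV. \<Sum>k\<in>UNIV. form_coeff s i k *\<^sub>C (N i j * N k l)) = - (1 / Q_const a) *\<^sub>C ?l"
    by (simp only: jl N_def sum_UNIV_prod form_coeff_def prod.case complex_vector.scale_sum_right
        scaleC_scaleC)
  also have "\<dots> = form_coeff s j l *\<^sub>C 1"
    by (simp only: eq jl form_coeff_def prod.case scaleC_scaleC)
  finally show ?thesis .
qed

lemma (in quantum_bispinors) coaction_G_metric:
  "\<Delta>\<^sub>L (\<Sum>I\<in>UNIV. \<Sum>J\<in>UNIV. G_metric e a s \<sigma> $ I $ J *\<^sub>C (X I * X J)) =
    1 \<otimes> (\<Sum>I\<in>UNIV. \<Sum>J\<in>UNIV. G_metric e a s \<sigma> $ I $ J *\<^sub>C (X I * X J))"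
proof -
  let ?Y = "\<lambda>q :: 2 \<times> 2. Xs (fst q) (snd q)"
  have "(\<Sum>I\<in>UNIV. \<Sum>J\<in>UNIV. G_metric e a s \<sigma> $ I $ J *\<^sub>C (X I * X J))
      = (\<Sum>q\<in>UNIV. \<Sum>r\<in>UNIV. form_coeff s q r *\<^sub>C (?Y q * ?Y r))"
    unfolding G_metric_eq_form_coeff
    by (rule quadratic_element_change_generators[symmetric]) (rule X_def)
  moreover have "\<Delta>\<^sub>L (\<Sum>q\<in>UNIV. \<Sum>r\<in>UNIV. form_coeff s q r *\<^sub>C (?Y q * ?Y r))
      = 1 \<otimes> (\<Sum>q\<in>UNIV. \<Sum>r\<in>UNIV. form_coeff s q r *\<^sub>C (?Y q * ?Y r))"
    by (rule invariant_quadratic_element[OF coaction_hom _ form_coeff_invariant])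
      (simp add: sum_UNIV_prod coaction_X split_def)
  ultimately show ?thesis by simp
qed

theorem mainTheorem2:
  fixes e :: "complex^2^2" and a :: real
    and st :: "'a::complex_algebra_1 \<Rightarrow> 'a"
    and \<Delta> :: "'a \<Rightarrow> ('a, 'a) tensor"
    and \<epsilon> :: "'a \<Rightarrow> complex"
    and S :: "'a \<Rightarrow> 'a"
    and M :: "2 \<Rightarrow> 2 \<Rightarrow> 'a"
    and \<sigma> :: "4 \<Rightarrow> complex^2^2"
    and X :: "4 \<Rightarrow> 'b::complex_algebra_1"
    and Xs :: "2 \<Rightarrow> 2 \<Rightarrow> 'b"
    and \<Delta>\<^sub>L :: "'b \<Rightarrow> ('a, 'b) tensor"
    and s :: pm
  assumes "quantum_bispinors e a st \<Delta> \<epsilon> S M \<sigma> X Xs \<Delta>\<^sub>L"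
  shows "invertible (G_metric e a s \<sigma>) \<and>
    (\<forall>I J. G_metric e a s \<sigma> $ I $ J =
      1 / Q_const a *
        (\<Sum>\<alpha>\<in>UNIV. \<Sum>\<nu>\<in>UNIV. \<Sum>\<beta>\<in>UNIV. \<Sum>\<gamma>\<in>UNIV.
          eps_up e \<alpha> \<nu> * \<sigma> I $ \<alpha> $ \<beta> * sigma_bar e a s \<sigma> J \<beta> \<gamma> * eps_lo e \<gamma> \<nu>)) \<and>
    (\<forall>I J. G_metric e a s \<sigma> $ I $ J =
      1 / Q_const a *
        (\<Sum>\<nu>\<in>UNIV. \<Sum>\<gamma>\<in>UNIV. \<Sum>\<alpha>\<in>UNIV. \<Sum>\<beta>\<in>UNIV.
          epsd_lo e \<nu> \<gamma> * sigma_bar e a s \<sigma> I \<gamma> \<alpha> * \<sigma> J $ \<alpha> $ \<beta> * epsd_up e \<nu> \<beta>)) \<and>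
    \<Delta>\<^sub>L (\<Sum>I\<in>UNIV. \<Sum>J\<in>UNIV. G_metric e a s \<sigma> $ I $ J *\<^sub>C (X I * X J)) =
      1 \<otimes> (\<Sum>I\<in>UNIV. \<Sum>J\<in>UNIV. G_metric e a s \<sigma> $ I $ J *\<^sub>C (X I * X J)) \<and>
    ((\<forall>I \<alpha> \<beta>. cnj (\<sigma> I $ \<alpha> $ \<beta>) = \<sigma> I $ \<beta> $ \<alpha>) \<longrightarrow>
      (\<forall>I J. cnj (G_metric e a s \<sigma> $ I $ J) = G_metric e a s \<sigma> $ J $ I))"
proof -
  interpret quantum_bispinors e a st \<Delta> \<epsilon> S M \<sigma> X Xs \<Delta>\<^sub>L
    by (rule assms)
  show ?thesis
  proof (intro conjI)
    show "invertible (G_metric e a s \<sigma>)"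
      by (rule invertible_G_metric[OF sigma_indep])
  next
    show "\<forall>I J. G_metric e a s \<sigma> $ I $ J = 1 / Q_const a *
        (\<Sum>\<alpha>\<in>UNIV. \<Sum>\<nu>\<in>UNIV. \<Sum>\<beta>\<in>UNIV. \<Sum>\<gamma>\<in>UNIV.
          eps_up e \<alpha> \<nu> * \<sigma> I $ \<alpha> $ \<beta> * sigma_bar e a s \<sigma> J \<beta> \<gamma> * eps_lo e \<gamma> \<nu>)"
      by (simp only: G_metric_def vec_lambda_beta simp_thms)
  qed (use G_metric_dotted coaction_G_metric G_metric_hermitean in \<open>blast+\<close>)
qed

end
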